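(* Let $(\mathcal A,\tau)$ be a unital noncommutative probability space with $\tau$ a faithful tracial state. Let $L\ge1$ be fixed and, for each $n\ge1$, let $g_n=([n]\times[L],E(g_n))$ be a finite simple graph on the vertex set $[n]\times[L]$. Assume that $w_{G_{g_n}}\to w$, where $w$ is an $\mathcal M_L$-decorated graphon. Let $a\in\mathcal A$ be a self-adjoint random variable with mean zero and variance one and, for each $n$, let $(a_k^{(r)})_{k\in[n],\,r\in[L]}$ be $g_n$-independent and identically distributed self-adjoint random variables with common law that of $a$. Let $$S_n^{(r)}=\frac{1}{\sqrt n}\sum_{k\in[n]}a_k^{(r)},\qquad r\in[L].$$ Then $(S_n^{(r)})_{r\in[L]}$ converges in distribution, as $n\to\infty$, to a family $(s_r)_{r\in[L]}$ whose joint distribution $\nu_w$ depends only on $w$. Moreover, for every $p\ge1$ and $l\in[L]^p$, $$\tau(s_{l_1}\cdots s_{l_p})=\sum_{\substack{\pi\in P_2(p)\\ \pi\le\ker(l)}}\rho(F^l_{f_\pi},w)=:\nu_w(l).$$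
   Context: Noncommutative probability: $\mathcal A$ is a unital $*$-algebra over $\mathbb C$ and $\tau:\mathcal A\to\mathbb C$ is linear with $\tau(1)=1$, $\tau(a^*a)\ge0$, faithful and tracial. The mean of $a$ is $\tau(a)$, and the variance of a centered self-adjoint $a$ is $\tau(a^2)$. Self-adjoint elements have the same law if all their moments agree. Convergence in distribution of a family $(S_n^{(r)})_{r\in[L]}$ to $(s_r)_{r\in[L]}$ (living in some noncommutative probability space whose functional is still denoted $\tau$) means $\tau(S_n^{(l_1)}\cdots S_n^{(l_p)})\to\tau(s_{l_1}\cdots s_{l_p})$ for all $p\ge1$, $l\in[L]^p$. $g$-independence: let $g=(I,E)$ be a finite loopless (undirected) graph. Unital subalgebras $(\mathcal A_i)_{i\in I}$ of $\mathcal A$ are $g$-independent if (1) for every $(i,j)\in E$, $\mathcal A_i$ and $\mathcal A_j$ are classically independent, i.e. they commute and $\tau(ab)=0$ for all centered $a\in\mathcal A_i$, $b\in\mathcal A_j$; (2) for every $k\ge1$ and every $i\in I^k$ such that for all $j_1<j_2$ with $i_{j_1}=i_{j_2}$ there exists $j_1<j_3<j_2$ with $(i_{j_1},i_{j_3})\notin E$, one has $\tau(a_1\cdots a_k)=0$ for all centered $a_j\in\mathcal A_{i_j}$. Self-adjoint elements are $g$-independent if the unital subalgebras they generate are. Decorated graphs and graphons: $\mathcal M_L$ is the set of $L\times L$ matrices with entries in $[0,1]$, with $\langle S,T\rangle=\sum_{i,j}S_{ij}T_{ij}$ and $\|S\|_{\mathrm{HS}}^2=\sum_{i,j}S_{ij}^2$.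 An $\mathcal M_L$-decorated graphon is a measurable map $w:[0,1]^2\to\mathcal M_L$ with $\|w(x,y)\|_{\mathrm{HS}}=\|w(y,x)\|_{\mathrm{HS}}$ for all $x,y$. An $\mathcal M_L$-decorated graph $F=(f,\beta)$ is a finite simple graph $f$ with a map $\beta:E(f)\to\mathcal M_L$, where each edge $e=(u,v)$ is written with a chosen orientation (any orientation is allowed). Put $$\rho(F,w)=\int_{[0,1]^{V(f)}}\prod_{e=(u,v)\in E(f)}\langle\beta(e),w(x_u,x_v)\rangle\,\mathrm dx$$ (each edge counted once). For decorated graphons, $w_n\to w$ means $\rho(F,w_n)\to\rho(F,w)$ for every $\mathcal M_L$-decorated graph $F$. The decorated graph $G_{g_n}$ is the complete graph on $[n]$ with decoration $\gamma(u,v)=\big(\mathbf 1_{((u,i),(v,j))\in E(g_n)}\big)_{i,j\in[L]}$, $u,v\in[n]$, and $w_{G_{g_n}}(x,y)=\gamma(u,v)$ for $(x,y)\in[\frac{u-1}n,\frac un)\times[\frac{v-1}n,\frac vn)$. Partitions: $P_2(p)$ is the set of pair partitions of $[p]$ (empty sum for $p$ odd). For $l\in[L]^p$, $\pi\le\ker(l)$ means $l_u=l_v$ whenever $u,v$ are in the same block of $\pi$. Two blocks cross if there are $i<k<j<m$ with $\{i,j\}$ contained in one of them and $\{k,m\}$ in the other; the intersection graph $f_\pi$ has the blocks of $\pi$ as vertices, with an edge between two distinct blocks iff they cross. For $\pi\le\ker(l)$ write $l_V$ for the common value of $l$ on the block $V$; then $F^l_{f_\pi}=(f_\pi,\beta_l)$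 with $\beta_l(U,V)=P_{l_U,l_V}$, where $P_{i,j}\in\mathcal M_L$ is the matrix unit with a $1$ in position $(i,j)$ and zeros elsewhere; thus $\rho(F^l_{f_\pi},w)=\int\prod_{(U,V)\in E(f_\pi)}w_{l_U,l_V}(x_U,x_V)\,\mathrm dx$. *)

theory Defs
  imports
    "HOL-Analysis.Analysis"
    "HOL-Library.Disjoint_Sets"
    "HOL-Algebra.Module"
    "HOL-Algebra.Subrings"
    "HOL-Algebra.Algebraic_Closure_Type"
    "Graph_Theory.Pair_Digraph"
begin

section \<open>Noncommutative probability spaces\<close>

abbreviation complex_ring :: "complex ring" where
  "complex_ring \<equiv> ring_of_type_algebra"

record 'a nc_space = "(complex, 'a) module" +
  involution :: "'a \<Rightarrow> 'a"
  state :: "'a \<Rightarrow> complex"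

text \<open>
  The library locale \<open>algebra\<close> requires a commutative multiplication, so compatibility of the
  scalar action with the product is stated here.  Spaces carry an explicit carrier set, which
  allows their existence to be asserted in a theorem.
\<close>

locale nc_prob_space =
  module "complex_ring" A + ring A
  for A :: "('a, 'b) nc_space_scheme" (structure) +
  assumes smult_mult_left: "\<lbrakk>x \<in> carrier A; y \<in> carrier A\<rbrakk> \<Longrightarrow> (c \<odot> x) \<otimes> y = c \<odot> (x \<otimes> y)"
    and smult_mult_right: "\<lbrakk>x \<in> carrier A; y \<in> carrier A\<rbrakk> \<Longrightarrow> x \<otimes> (c \<odot> y) = c \<odot> (x \<otimes> y)"
    and involution_closed: "x \<in> carrier A \<Longrightarrow> involution A x \<in> carrier A"
    and involution_involution: "x \<in> carrier A \<Longrightarrow> involution A (involution A x) = x"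
    and involution_add: "\<lbrakk>x \<in> carrier A; y \<in> carrier A\<rbrakk> \<Longrightarrow>
          involution A (x \<oplus> y) = involution A x \<oplus> involution A y"
    and involution_smult: "x \<in> carrier A \<Longrightarrow> involution A (c \<odot> x) = cnj c \<odot> involution A x"
    and involution_mult: "\<lbrakk>x \<in> carrier A; y \<in> carrier A\<rbrakk> \<Longrightarrow>
          involution A (x \<otimes> y) = involution A y \<otimes> involution A x"
    and state_add: "\<lbrakk>x \<in> carrier A; y \<in> carrier A\<rbrakk> \<Longrightarrow> state A (x \<oplus> y) = state A x + state A y"
    and state_smult: "x \<in> carrier A \<Longrightarrow> state A (c \<odot> x) = c * state A x"
    and state_one: "state A \<one> = 1"
    and state_pos: "x \<in> carrier A \<Longrightarrow> state A (involution A x \<otimes> x) \<in> \<real>\<^sub>\<ge>\<^sub>0"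
    and state_faithful: "\<lbrakk>x \<in> carrier A; state A (involution A x \<otimes> x) = 0\<rbrakk> \<Longrightarrow> x = \<zero>"
    and state_tracial: "\<lbrakk>x \<in> carrier A; y \<in> carrier A\<rbrakk> \<Longrightarrow> state A (x \<otimes> y) = state A (y \<otimes> x)"

definition self_adjoint :: "('a, 'b) nc_space_scheme \<Rightarrow> 'a \<Rightarrow> bool" where
  "self_adjoint A x \<longleftrightarrow> x \<in> carrier A \<and> involution A x = x"

definition centered :: "('a, 'b) nc_space_scheme \<Rightarrow> 'a \<Rightarrow> bool" where
  "centered A x \<longleftrightarrow> x \<in> carrier A \<and> state A x = 0"

definition same_law :: "('a, 'b) nc_space_scheme \<Rightarrow> 'a \<Rightarrow> 'a \<Rightarrow> bool" where
  "same_law A x y \<longleftrightarrow> (\<forall>m::nat. state A (x [^]\<^bsub>A\<^esub> m) = state A (y [^]\<^bsub>A\<^esub> m))"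

text \<open>The ordered product \<open>x 1 \<otimes> \<dots> \<otimes> x p\<close>.\<close>

definition ordered_prod :: "('a, 'b) nc_space_scheme \<Rightarrow> nat \<Rightarrow> (nat \<Rightarrow> 'a) \<Rightarrow> 'a" where
  "ordered_prod A p x = foldr (\<otimes>\<^bsub>A\<^esub>) (map x [1..<p+1]) \<one>\<^bsub>A\<^esub>"

text \<open>Words of length \<open>p\<close> are functions \<open>l\<close> on \<open>nat\<close>, of which only the values on \<open>{1..p}\<close> matter.\<close>

definition converges_in_distribution ::
  "('a, 'c) nc_space_scheme \<Rightarrow> (nat \<Rightarrow> 'i \<Rightarrow> 'a) \<Rightarrow> ('b, 'd) nc_space_scheme \<Rightarrow> ('i \<Rightarrow> 'b) \<Rightarrow> bool" where
  "converges_in_distribution A S B s \<longleftrightarrow>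
     (\<forall>p\<ge>1. \<forall>l :: nat \<Rightarrow> 'i.
        (\<lambda>n. state A (ordered_prod A p (\<lambda>u. S n (l u))))
          \<longlonglongrightarrow> state B (ordered_prod B p (\<lambda>u. s (l u))))"


section \<open>Independence with respect to a graph\<close>

definition unital_subalgebra :: "('a, 'b) nc_space_scheme \<Rightarrow> 'a set \<Rightarrow> bool" where
  "unital_subalgebra A H \<longleftrightarrow> subring H A \<and> submodule H complex_ring A"

definition generated_subalgebra :: "('a, 'b) nc_space_scheme \<Rightarrow> 'a \<Rightarrow> 'a set" where
  "generated_subalgebra A x = \<Inter>{H. unital_subalgebra A H \<and> x \<in> H}"

definition classically_independent ::
  "('a, 'b) nc_space_scheme \<Rightarrow> 'a set \<Rightarrow> 'a set \<Rightarrow> bool" where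
  "classically_independent A H K \<longleftrightarrow>
     (\<forall>x\<in>H. \<forall>y\<in>K. x \<otimes>\<^bsub>A\<^esub> y = y \<otimes>\<^bsub>A\<^esub> x) \<and>
     (\<forall>x\<in>H. \<forall>y\<in>K. centered A x \<longrightarrow> centered A y \<longrightarrow> state A (x \<otimes>\<^bsub>A\<^esub> y) = 0)"

definition g_independent_subalgebras ::
  "('a, 'b) nc_space_scheme \<Rightarrow> 'i pair_pre_digraph \<Rightarrow> ('i \<Rightarrow> 'a set) \<Rightarrow> bool" where
  "g_independent_subalgebras A g H \<longleftrightarrow>
     (\<forall>(i, j) \<in> parcs g. classically_independent A (H i) (H j)) \<and>
     (\<forall>k\<ge>1. \<forall>i :: nat \<Rightarrow> 'i. \<forall>x :: nat \<Rightarrow> 'a.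
        (\<forall>j\<in>{1..k}. i j \<in> pverts g) \<longrightarrow>
        (\<forall>j1\<in>{1..k}. \<forall>j2\<in>{1..k}. j1 < j2 \<and> i j1 = i j2 \<longrightarrow>
           (\<exists>j3. j1 < j3 \<and> j3 < j2 \<and> (i j1, i j3) \<notin> parcs g)) \<longrightarrow>
        (\<forall>j\<in>{1..k}. x j \<in> H (i j) \<and> centered A (x j)) \<longrightarrow>
        state A (ordered_prod A k x) = 0)"

definition g_independent ::
  "('a, 'b) nc_space_scheme \<Rightarrow> 'i pair_pre_digraph \<Rightarrow> ('i \<Rightarrow> 'a) \<Rightarrow> bool" where
  "g_independent A g x \<longleftrightarrow> g_independent_subalgebras A g (\<lambda>i. generated_subalgebra A (x i))"

definition normalized_sum ::
  "('a, 'b) nc_space_scheme \<Rightarrow> nat \<Rightarrow> (nat \<Rightarrow> 'a) \<Rightarrow> 'a" where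
  "normalized_sum A n x = complex_of_real (1 / sqrt (real n)) \<odot>\<^bsub>A\<^esub> finsum A x {1..n}"


section \<open>Decorated graphs and graphons\<close>

text \<open>
  The index set \<open>[L]\<close> is a finite type \<open>'l\<close> with \<open>L = CARD('l)\<close>.  On \<open>real^'l^'l\<close> the library's
  inner product and norm are the entrywise sum of products and the Hilbert--Schmidt norm.
\<close>

definition unit_matrices :: "(real^'l::finite^'l) set" where
  "unit_matrices = {S. \<forall>i j. S $ i $ j \<in> {0..1}}"

definition matrix_unit :: "'l::finite \<Rightarrow> 'l \<Rightarrow> real^'l^'l" where
  "matrix_unit i j = axis i (axis j 1)"

definition decorated_graphon :: "(real \<Rightarrow> real \<Rightarrow> real^'l::finite^'l) \<Rightarrow> bool" where
  "decorated_graphon w \<longleftrightarrow>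
     (\<lambda>(x, y). w x y) \<in> borel_measurable (lebesgue_on ({0..1} \<times> {0..1})) \<and>
     (\<forall>x\<in>{0..1}. \<forall>y\<in>{0..1}. w x y \<in> unit_matrices \<and> norm (w x y) = norm (w y x))"

text \<open>A simple graph has both arcs \<open>(u, v)\<close> and \<open>(v, u)\<close> for each edge; an orientation picks one.\<close>

definition orientation :: "'v pair_pre_digraph \<Rightarrow> ('v \<times> 'v) set \<Rightarrow> bool" where
  "orientation f D \<longleftrightarrow> D \<inter> D\<inverse> = {} \<and> D \<union> D\<inverse> = parcs f"

record ('v, 'l) dec_graph =
  underlying :: "'v pair_pre_digraph"
  oriented_edges :: "('v \<times> 'v) set"
  decoration :: "'v \<times> 'v \<Rightarrow> real^'l^'l"

definition decorated_graph :: "('v, 'l::finite) dec_graph \<Rightarrow> bool" where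
  "decorated_graph F \<longleftrightarrow>
     pair_graph (underlying F) \<and>
     orientation (underlying F) (oriented_edges F) \<and>
     (\<forall>e\<in>oriented_edges F. decoration F e \<in> unit_matrices)"

text \<open>The completion makes the integrand measurable when \<open>w\<close> is only Lebesgue measurable.\<close>

definition hom_density :: "('v, 'l::finite) dec_graph \<Rightarrow> (real \<Rightarrow> real \<Rightarrow> real^'l^'l) \<Rightarrow> real" where
  "hom_density F w =
     (\<integral>x. (\<Prod>(u, v)\<in>oriented_edges F. decoration F (u, v) \<bullet> w (x u) (x v))
        \<partial>completion (\<Pi>\<^sub>M v\<in>pverts (underlying F). restrict_space lborel {0..1}))"

text \<open>Every finite graph is isomorphic to one with vertices in \<open>nat\<close>, so testing on these suffices.\<close>

definition graphon_converges ::
  "(nat \<Rightarrow> real \<Rightarrow> real \<Rightarrow> real^'l::finite^'l) \<Rightarrow> (real \<Rightarrow> real \<Rightarrow> real^'l^'l) \<Rightarrow> bool" where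
  "graphon_converges wn w \<longleftrightarrow>
     (\<forall>F :: (nat, 'l) dec_graph. decorated_graph F \<longrightarrow>
        (\<lambda>n. hom_density F (wn n)) \<longlonglongrightarrow> hom_density F w)"

definition block_decoration ::
  "(nat \<times> 'l::finite) pair_pre_digraph \<Rightarrow> nat \<Rightarrow> nat \<Rightarrow> real^'l^'l" where
  "block_decoration g u v = (\<chi> i j. if ((u, i), (v, j)) \<in> parcs g then 1 else 0)"

text \<open>The value at points with \<open>x = 1\<close> or \<open>y = 1\<close>, a null set, is \<open>0\<close>.\<close>

definition block_graphon ::
  "nat \<Rightarrow> (nat \<times> 'l::finite) pair_pre_digraph \<Rightarrow> real \<Rightarrow> real \<Rightarrow> real^'l^'l" where
  "block_graphon n g x y =
     (\<Sum>u\<in>{1..n}. \<Sum>v\<in>{1..n}.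
        (indicator {(real u - 1) / real n..<real u / real n} x *
         indicator {(real v - 1) / real n..<real v / real n} y) *\<^sub>R block_decoration g u v)"


section \<open>Pair partitions\<close>

definition pair_partitions :: "nat \<Rightarrow> nat set set set" where
  "pair_partitions p = {\<pi>. partition_on {1..p} \<pi> \<and> (\<forall>V\<in>\<pi>. card V = 2)}"

definition le_ker :: "nat set set \<Rightarrow> (nat \<Rightarrow> 'l) \<Rightarrow> bool" where
  "le_ker \<pi> l \<longleftrightarrow> (\<forall>V\<in>\<pi>. \<forall>u\<in>V. \<forall>v\<in>V. l u = l v)"

definition crossing :: "nat set \<Rightarrow> nat set \<Rightarrow> bool" where
  "crossing U V \<longleftrightarrow>
     (\<exists>i k j m. i < k \<and> k < j \<and> j < m \<and>
        ({i, j} \<subseteq> U \<and> {k, m} \<subseteq> V \<or> {i, j} \<subseteq> V \<and> {k, m} \<subseteq> U))"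

definition intersection_graph :: "nat set set \<Rightarrow> nat set pair_pre_digraph" where
  "intersection_graph \<pi> =
     \<lparr>pverts = \<pi>, parcs = {(U, V). U \<in> \<pi> \<and> V \<in> \<pi> \<and> U \<noteq> V \<and> crossing U V}\<rparr>"

text \<open>\<open>the_elem (l ` V)\<close> is the common value of \<open>l\<close> on the block \<open>V\<close>.\<close>

definition partition_graph ::
  "(nat set \<times> nat set) set \<Rightarrow> nat set set \<Rightarrow> (nat \<Rightarrow> 'l::finite) \<Rightarrow> (nat set, 'l) dec_graph" where
  "partition_graph D \<pi> l =
     \<lparr>underlying = intersection_graph \<pi>, oriented_edges = D,
      decoration = (\<lambda>(U, V). matrix_unit (the_elem (l ` U)) (the_elem (l ` V)))\<rparr>"

text \<open>\<open>D \<pi>\<close> is the chosen orientation of the intersection graph of \<open>\<pi>\<close>.\<close>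

definition limit_moment ::
  "(nat set set \<Rightarrow> (nat set \<times> nat set) set) \<Rightarrow> (real \<Rightarrow> real \<Rightarrow> real^'l::finite^'l) \<Rightarrow>
     nat \<Rightarrow> (nat \<Rightarrow> 'l) \<Rightarrow> real" where
  "limit_moment D w p l =
     (\<Sum>\<pi> | \<pi> \<in> pair_partitions p \<and> le_ker \<pi> l. hom_density (partition_graph (D \<pi>) \<pi> l) w)"

end

theory Submission
  imports Defs "HOL-Library.Sublist" "HOL-Probability.Infinite_Product_Measure"
begin

text \<open>
  Expand a moment of the normalized sums over the index tuples \<open>k\<close>.  Centred powers of one
  variable that are separated only by variables commuting with it can be merged, and a word in
  which nothing can be merged has vanishing moment by independence; hence every moment is a
  function of the graph and of the common law.  In particular a word in which some variable
  occurs exactly once has moment \<open>0\<close>, and moments of a given length are uniformly bounded, so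
  that only the tuples \<open>k\<close> all of whose fibres have two elements survive in the limit.  For these
  an innermost pair can be contracted if and only if it is adjacent to all the pairs it crosses,
  so the moment is the indicator that the fibre labelling is a homomorphism of the intersection
  graph.  Up to the negligible non-injective labellings, the sum of these indicators is the
  homomorphism density of the block graphon.

  The limit is a positive tracial functional on words, hence it is the joint distribution of
  the letters in the quotient of the free algebra by the null ideal of the functional.
\<close>

section \<open>Words of centred powers\<close>

text \<open>There is no norm on the algebra that would bound products, and the graph changes with n.
  This is why moments are treated as a function of words of centred powers. Such words are closed
  under merging, with coefficients built from the common moments \<mu> alone; the graph only decides
  which merges are allowed. A constant that accounts for every conceivable merge is therefore
  uniform in n. The orders balance as follows. A moment of length p carries the factor n^(-p/2), and
  the tuples with fewer than p/2 values number at most a constant times n^q with q = floor((p-1)/2),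
  which leaves an error of order n^(-1/2). Tuples made of pairs only see \<mu> 1 = 0 and \<mu> 2 =
  1, so the limit forgets the rest of the law. A limit of faithful states need not be faithful;
  dividing by the null ideal repairs this. The density of a crossing graph is formed with a chosen
  orientation, while only the norms of w(x,y) and w(y,x) are assumed equal. That all orientations
  give the same value is not an integral identity here: all these values are limits of the same
  moments.\<close>

definition mergeable :: "('v \<times> 'v) set \<Rightarrow> ('v \<times> nat) list \<Rightarrow> bool" where
  "mergeable E ws \<longleftrightarrow> (\<exists>xs u m ys m' zs. ws = xs @ (u, m) # ys @ (u, m') # zs \<and>
     (\<forall>d\<in>set ys. (u, fst d) \<in> E))"

lemma append_Cons_unique:
  "x \<notin> set xs \<Longrightarrow> x \<notin> set xs' \<Longrightarrow> xs @ x # ys = xs' @ x # ys' \<Longrightarrow> xs = xs' \<and> ys = ys'"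
proof (induction xs arbitrary: xs')
  case Nil
  thus ?case by (cases xs') auto
next
  case (Cons y xs)
  thus ?case by (cases xs') auto
qed

text \<open>
  \<open>M ws\<close> is the moment of the word whose letter \<open>(v, m)\<close> stands for the centred power
  \<open>x\<^sub>v\<^sup>m - \<mu> m\<close>, where \<open>\<mu> m\<close> is the \<open>m\<close>-th moment of every \<open>x\<^sub>v\<close>.
\<close>

locale graph_moments =
  fixes V :: "'v set" and E :: "('v \<times> 'v) set" and \<mu> :: "nat \<Rightarrow> complex"
    and M :: "('v \<times> nat) list \<Rightarrow> complex"
  assumes sym_E: "(u, v) \<in> E \<Longrightarrow> (v, u) \<in> E"
    and irrefl_E: "(u, u) \<notin> E"
    and M_Nil: "M [] = 1"
    and M_merge: "\<lbrakk>fst ` set (xs @ (u, m) # ys @ (u, m') # zs) \<subseteq> V; \<forall>d\<in>set ys. (u, fst d) \<in> E\<rbrakk> \<Longrightarrow>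
      M (xs @ (u, m) # ys @ (u, m') # zs) =
        M (xs @ (u, m + m') # ys @ zs) - \<mu> m' * M (xs @ (u, m) # ys @ zs)
        - \<mu> m * M (xs @ (u, m') # ys @ zs) + (\<mu> (m + m') - \<mu> m * \<mu> m') * M (xs @ ys @ zs)"
    and M_reduced: "\<lbrakk>fst ` set ws \<subseteq> V; ws \<noteq> []; \<not> mergeable E ws\<rbrakk> \<Longrightarrow> M ws = 0"
begin

text \<open>A merge acts on a letter that occurs twice, hence not on v, and all four resulting
  shorter words still contain v exactly once. When no merge is left the word is nonempty, because v
  is in it, and its moment vanishes.\<close>

lemma M_singleton:
  assumes "fst ` set ws \<subseteq> V" "count_list (map fst ws) v = 1"
  shows "M ws = 0"
  using assms
proof (induction "length ws" arbitrary: ws rule: less_induct)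
  case less
  show ?case
  proof (cases "mergeable E ws")
    case False
    moreover have "ws \<noteq> []" using less.prems(2) by auto
    ultimately show ?thesis using M_reduced less.prems by blast
  next
    case True
    then obtain xs u m ys m' zs where ws: "ws = xs @ (u, m) # ys @ (u, m') # zs"
      and ys: "\<forall>d\<in>set ys. (u, fst d) \<in> E"
      unfolding mergeable_def by blast
    have uv: "u \<noteq> v" using less.prems(2) unfolding ws by auto
    have cnt: "count_list (map fst (xs @ ys @ zs)) v = 1"
      using less.prems(2) uv unfolding ws by simp
    have V: "fst ` set (xs @ ys @ zs) \<subseteq> V" "u \<in> V" using less.prems(1) unfolding ws by auto
    have "M (xs @ (u, k) # ys @ zs) = 0" for k
      using less.hyps[of "xs @ (u, k) # ys @ zs"] cnt V uv by (auto simp: ws)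
    moreover have "M (xs @ ys @ zs) = 0"
      using less.hyps[of "xs @ ys @ zs"] cnt V by (auto simp: ws)
    ultimately show ?thesis using M_merge[OF less.prems(1)[unfolded ws] ys] ws by simp
  qed
qed

text \<open>An innermost pair \<open>u \<dots> u\<close> of a word can be contracted exactly when every other letter that
  separates its two occurrences, and therefore crosses it, is adjacent to \<open>u\<close>.\<close>

lemma M_pairs:
  assumes "set vs \<subseteq> V" "\<forall>v\<in>set vs. count_list vs v = 2"
    and var: "\<mu> 1 = 0" "\<mu> 2 = 1"
  shows "M (map (\<lambda>v. (v, 1)) vs) =
    of_bool (\<forall>u v. u \<noteq> v \<longrightarrow> subseq [u, v, u, v] vs \<longrightarrow> (u, v) \<in> E)"
  using assms(1,2)
proof (induction "length vs" arbitrary: vs rule: less_induct)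
  case less
  let ?good = "\<lambda>vs. \<forall>u v. u \<noteq> v \<longrightarrow> subseq [u, v, u, v] vs \<longrightarrow> (u, v) \<in> E"
  let ?w = "map (\<lambda>v. (v, 1::nat))"
  show ?case
  proof (cases "\<exists>xs u ys zs. vs = xs @ u # ys @ u # zs \<and> (\<forall>d\<in>set ys. (u, d) \<in> E)")
    case True
    then obtain xs u ys zs where vs: "vs = xs @ u # ys @ u # zs"
      and ys: "\<forall>d\<in>set ys. (u, d) \<in> E" by blast
    let ?vs = "xs @ ys @ zs"
    have "count_list vs u = 2" using less.prems(2) unfolding vs by auto
    hence u0: "count_list ?vs u = 0" unfolding vs by simp
    hence u: "u \<notin> set ?vs" by (metis count_list_0_iff)
    have cnt: "\<forall>v\<in>set ?vs. count_list ?vs v = 2"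
    proof
      fix v assume v: "v \<in> set ?vs"
      hence "v \<noteq> u" using u by auto
      moreover have "count_list vs v = 2" using v less.prems(2) unfolding vs by auto
      ultimately show "count_list ?vs v = 2" unfolding vs by simp
    qed
    have V: "set ?vs \<subseteq> V" "u \<in> V" using less.prems(1) unfolding vs by auto
    have f: "?w ?vs = ?w xs @ ?w ys @ ?w zs" by simp
    \<comment> \<open>In the merging formula every term that keeps a copy of u vanishes, because u
      then occurs only once. What remains is the word without u, with coefficient \<mu> 2 - (\<mu>
      1)^2 = 1.\<close>
    have "M (?w xs @ (u, k) # ?w ys @ ?w zs) = 0" for k
    proof (rule M_singleton[where v = u])
      show "fst ` set (?w xs @ (u, k) # ?w ys @ ?w zs) \<subseteq> V" using V by auto
      show "count_list (map fst (?w xs @ (u, k) # ?w ys @ ?w zs)) u = 1"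
        using u0 by (simp add: comp_def)
    qed
    moreover have "M (?w vs) = M (?w xs @ (u, 1 + 1) # ?w ys @ ?w zs)
        - \<mu> 1 * M (?w xs @ (u, 1) # ?w ys @ ?w zs) - \<mu> 1 * M (?w xs @ (u, 1) # ?w ys @ ?w zs)
        + (\<mu> (1 + 1) - \<mu> 1 * \<mu> 1) * M (?w xs @ ?w ys @ ?w zs)"
    proof -
      have "fst ` set (?w xs @ (u, 1) # ?w ys @ (u, 1) # ?w zs) \<subseteq> V"
        "\<forall>d\<in>set (?w ys). (u, fst d) \<in> E"
        using V ys by auto
      from M_merge[OF this] show ?thesis unfolding vs by simp
    qed
    ultimately have "M (?w vs) = M (?w ?vs)"
      using var by (simp add: numeral_2_eq_2)
    also have "\<dots> = of_bool (?good ?vs)"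
      by (rule less.hyps) (use V cnt vs in auto)
    \<comment> \<open>Deleting u changes no crossing between other letters. A letter that crosses u
      has a copy between the two copies of u, that is in \<open>ys\<close>, so it is adjacent to u
      already.\<close>
    also have "?good ?vs = ?good vs"
    proof
      assume g: "?good vs"
      have "subseq ?vs vs" unfolding vs
        by (intro list_emb_append_mono subseq_order.refl list_emb_Cons)
      hence "subseq [c, d, c, d] ?vs \<Longrightarrow> subseq [c, d, c, d] vs" for c d
        by (rule subseq_order.trans[rotated])
      thus "?good ?vs" using g by (intro allI impI) (elim allE impE, assumption+)
    next
      assume g: "?good ?vs"
      show "?good vs"
      proof (intro allI impI)
        fix c d assume cd: "c \<noteq> d" and sub: "subseq [c, d, c, d] vs"
        \<comment> \<open>As u occurs exactly twice, any pattern u, e, u uses precisely the two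
          copies that enclose \<open>ys\<close>.\<close>
        have mid: "e \<in> set ys" if "e \<noteq> u" and s: "subseq [u, e, u] vs" for e
        proof -
          from list_emb_ConsD[OF s] obtain as bs where 1: "vs = as @ u # bs" "subseq [e, u] bs"
            by auto
          from list_emb_ConsD[OF 1(2)] obtain cs ds where 2: "bs = cs @ e # ds" "subseq [u] ds"
            by auto
          from list_emb_ConsD[OF 2(2)] obtain gs hs where 3: "ds = gs @ u # hs" by auto
          have e: "vs = as @ u # (cs @ e # gs) @ u # hs" using 1 2 3 by simp
          have nu: "u \<notin> set as" "u \<notin> set (cs @ e # gs)"
          proof -
            have "count_list vs u = 2" by fact
            thus "u \<notin> set as" "u \<notin> set (cs @ e # gs)" using e \<open>e \<noteq> u\<close> by (auto simp: count_list_0_iff[symmetric] simp del: count_list_0_iff)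
          qed
          have "ys @ u # zs = (cs @ e # gs) @ u # hs"
            using e[unfolded vs] u nu(1) append_Cons_unique[of u xs as] by auto
          hence "ys = cs @ e # gs"
            using nu(2) u append_Cons_unique[of u ys "cs @ e # gs" zs hs] by auto
          thus ?thesis by simp
        qed
        consider "c = u" | "d = u" | "c \<noteq> u" "d \<noteq> u" by blast
        thus "(c, d) \<in> E"
        proof cases
          case 1
          have "subseq [c, d, c] [c, d, c, d]" by simp
          thus ?thesis using mid[of d] 1 cd sub ys subseq_order.trans by metis
        next
          case 2
          have "subseq [d, c, d] [c, d, c, d]" by simp
          hence "(u, c) \<in> E" using mid[of c] 2 cd sub ys subseq_order.trans by metis
          thus ?thesis using 2 sym_E by simp
        next
          case 3
          have "subseq (filter (\<lambda>a. a \<noteq> u) [c, d, c, d]) (filter (\<lambda>a. a \<noteq> u) vs)"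
            using sub by (rule subseq_filter)
          moreover have "filter (\<lambda>a. a \<noteq> u) vs = ?vs"
          proof -
            have "u \<notin> set as \<Longrightarrow> filter (\<lambda>a. a \<noteq> u) as = as" for as by (induction as) auto
            thus ?thesis using u unfolding vs by simp
          qed
          ultimately have "subseq [c, d, c, d] ?vs" using 3 by simp
          thus ?thesis using g cd by blast
        qed
      qed
    qed
    finally show ?thesis .
  next
    case False
    show ?thesis
    proof (cases "vs = []")
      case True
      thus ?thesis using M_Nil by simp
    next
      case ne: False
      have "\<not> mergeable E (?w vs)"
      proof
        assume "mergeable E (?w vs)"
        then obtain xs u m ys m' zs where e: "?w vs = xs @ (u, m) # ys @ (u, m') # zs"
          and ys: "\<forall>d\<in>set ys. (u, fst d) \<in> E" unfolding mergeable_def by blast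
        have "map fst (?w vs) = vs" by (simp add: comp_def)
        hence "vs = map fst xs @ u # map fst ys @ u # map fst zs" unfolding e by simp
        thus False using False ys by fastforce
      qed
      hence "M (?w vs) = 0" using M_reduced[of "?w vs"] ne less.prems(1) by fastforce
      moreover have "\<not> ?good vs"
      proof
        assume g: "?good vs"
        \<comment> \<open>Take two equal letters u at the smallest distance. By minimality a letter
          d between them occurs there once, so its other copy lies outside and d crosses u. The
          assumption \<open>g\<close> then makes d adjacent to u, and the word could be contracted
          after all.\<close>
        let ?P = "\<lambda>n. \<exists>xs u ys zs. vs = xs @ u # ys @ u # zs \<and> length ys = n"
        have "\<exists>n. ?P n"
        proof -
          obtain u ts where u: "vs = u # ts" using ne by (cases vs) auto
          hence "count_list ts u = 1" using less.prems(2) by simp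
          hence "u \<in> set ts" by (metis count_list_0_iff zero_neq_one)
          then obtain ys zs where "ts = ys @ u # zs" by (meson split_list)
          thus ?thesis using u append_Nil by metis
        qed
        then obtain n where n: "?P n" and min: "\<And>k. k < n \<Longrightarrow> \<not> ?P k"
          using LeastI_ex[of ?P] not_less_Least[of _ ?P] by blast
        then obtain xs u ys zs where vs: "vs = xs @ u # ys @ u # zs" "length ys = n" by blast
        have "(u, d) \<in> E" if d: "d \<in> set ys" for d
        proof -
          obtain ps qs where ys: "ys = ps @ d # qs" using d by (meson split_list)
          have du: "d \<noteq> u"
          proof
            assume "d = u"
            hence "?P (length ps)" using vs ys by force
            moreover have "length ps < n" using vs ys by simp
            ultimately show False using min by blast
          qed
          have ps: "d \<notin> set ps"
          proof
            assume "d \<in> set ps"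
            then obtain as bs where "ps = as @ d # bs" by (meson split_list)
            hence "vs = (xs @ u # as) @ d # bs @ d # (qs @ u # zs)" "length bs < n"
              using vs ys by auto
            thus False using min[of "length bs"] by blast
          qed
          have qs: "d \<notin> set qs"
          proof
            assume "d \<in> set qs"
            then obtain as bs where "qs = as @ d # bs" by (meson split_list)
            hence "vs = (xs @ u # ps) @ d # as @ d # (bs @ u # zs)" "length as < n"
              using vs ys by auto
            thus False using min[of "length as"] by blast
          qed
          have "d \<in> set vs" using vs d by simp
          hence "count_list vs d = 2" using less.prems(2) by blast
          hence "count_list xs d + count_list zs d = 1"
            using vs(1) ys du ps qs by simp
          hence "d \<in> set xs \<or> d \<in> set zs"
            by (metis count_notin add_0 zero_neq_one)
          thus "(u, d) \<in> E"
          proof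
            assume "d \<in> set xs"
            then obtain as bs where "xs = as @ d # bs" by (meson split_list)
            hence "vs = as @ d # (bs @ u # (ps @ d # (qs @ u # zs)))" using vs ys by simp
            hence "subseq [d, u, d, u] vs" by (simp add: list_emb_append2)
            thus ?thesis using g du sym_E by blast
          next
            assume "d \<in> set zs"
            then obtain as bs where "zs = as @ d # bs" by (meson split_list)
            hence "vs = xs @ u # (ps @ d # (qs @ u # (as @ d # bs)))" using vs ys by simp
            hence "subseq [u, d, u, d] vs" by (simp add: list_emb_append2)
            thus ?thesis using g du by metis
          qed
        qed
        thus False using False vs(1) by blast
      qed
      ultimately show ?thesis by simp
    qed
  qed
qed

end

text \<open>Graph and \<open>M\<close> are quantified inside, so that C depends on \<mu> and the
  exponents alone. A merge produces words with strictly fewer letters whose exponent lists are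
  determined by the old list and the place of the merge. The induction is on the number of letters,
  since the exponents themselves grow.\<close>

lemma graph_moments_bound:
  fixes \<mu> :: "nat \<Rightarrow> complex"
  shows "\<exists>C. \<forall>V (E :: ('v \<times> 'v) set) M ws. graph_moments V E \<mu> M \<longrightarrow> fst ` set ws \<subseteq> V \<longrightarrow>
    map snd ws = ms \<longrightarrow> norm (M ws) \<le> C"
proof (induction "length ms" arbitrary: ms rule: less_induct)
  case less
  let ?B = "\<lambda>ms C. \<forall>V (E :: ('v \<times> 'v) set) M ws. graph_moments V E \<mu> M \<longrightarrow> fst ` set ws \<subseteq> V \<longrightarrow>
    map snd ws = ms \<longrightarrow> norm (M ws) \<le> C"
  have "\<exists>C. \<forall>ks. length ks < length ms \<longrightarrow> ?B ks (C ks)"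
    using less.hyps by metis
  then obtain C where C: "\<And>ks. length ks < length ms \<Longrightarrow> ?B ks (C ks)" by blast
  \<comment> \<open>The graph decides where a merge is possible, so the constant sums over all
    conceivable places. The absolute values in \<open>K\<close> keep each summand nonnegative
    whatever the sign of the chosen C.\<close>
  define T where "T = {(as, m, bs, m', cs). ms = as @ m # bs @ m' # cs}"
  have "T \<subseteq> {as. set as \<subseteq> set ms \<and> length as \<le> length ms} \<times> set ms \<times>
      {as. set as \<subseteq> set ms \<and> length as \<le> length ms} \<times> set ms \<times>
      {as. set as \<subseteq> set ms \<and> length as \<le> length ms}"
    unfolding T_def by auto
  hence T: "finite T"
    by (rule finite_subset) (intro finite_cartesian_product finite_lists_length_le finite_set)
  define K where "K = (\<lambda>(as, m, bs, m', cs).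
      \<bar>C (as @ (m + m') # bs @ cs)\<bar> + norm (\<mu> m') * \<bar>C (as @ m # bs @ cs)\<bar>
      + norm (\<mu> m) * \<bar>C (as @ m' # bs @ cs)\<bar>
      + norm (\<mu> (m + m') - \<mu> m * \<mu> m') * \<bar>C (as @ bs @ cs)\<bar>)"
  have K0: "0 \<le> K t" for t unfolding K_def by (auto split: prod.split)
  \<comment> \<open>The summand 1 covers unmergeable words: \<open>M\<close> is 1 on the empty word
    and 0 on the others.\<close>
  have "?B ms (1 + sum K T)"
  proof (intro allI impI)
    fix V and E :: "('v \<times> 'v) set" and M ws
    assume gm: "graph_moments V E \<mu> M" and V: "fst ` set ws \<subseteq> V" and ws: "map snd ws = ms"
    interpret graph_moments V E \<mu> M by fact
    show "norm (M ws) \<le> 1 + sum K T"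
    proof (cases "mergeable E ws")
      case False
      have "norm (M ws) \<le> 1" using M_Nil M_reduced[OF V] False by (cases "ws = []") auto
      thus ?thesis using sum_nonneg[of T K] K0 by force
    next
      case True
      then obtain xs u m ys m' zs where e: "ws = xs @ (u, m) # ys @ (u, m') # zs"
        and ys: "\<forall>d\<in>set ys. (u, fst d) \<in> E" unfolding mergeable_def by blast
      let ?as = "map snd xs" and ?bs = "map snd ys" and ?cs = "map snd zs"
      have ms: "ms = ?as @ m # ?bs @ m' # ?cs" using ws e by simp
      hence inT: "(?as, m, ?bs, m', ?cs) \<in> T" unfolding T_def by simp
      have V': "fst ` set xs \<subseteq> V" "fst ` set ys \<subseteq> V" "fst ` set zs \<subseteq> V" "u \<in> V"
        using V unfolding e by auto
      have c: "norm (M (xs @ (u, k) # ys @ zs)) \<le> \<bar>C (?as @ k # ?bs @ ?cs)\<bar>" for k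
      proof -
        have "norm (M (xs @ (u, k) # ys @ zs)) \<le> C (?as @ k # ?bs @ ?cs)"
          by (rule C[rule_format]) (use gm V' in \<open>auto simp: ms\<close>)
        thus ?thesis by linarith
      qed
      have d: "norm (M (xs @ ys @ zs)) \<le> \<bar>C (?as @ ?bs @ ?cs)\<bar>"
      proof -
        have "norm (M (xs @ ys @ zs)) \<le> C (?as @ ?bs @ ?cs)"
          by (rule C[rule_format]) (use gm V' in \<open>auto simp: ms\<close>)
        thus ?thesis by linarith
      qed
      have tri: "norm (p - q - r + s) \<le> norm p + norm q + norm r + norm s" for p q r s :: complex
        using norm_triangle_ineq[of "p - q - r" s] norm_triangle_ineq4[of "p - q" r]
          norm_triangle_ineq4[of p q] by linarith
      have "norm (M ws) \<le> norm (M (xs @ (u, m + m') # ys @ zs)) +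
         norm (\<mu> m' * M (xs @ (u, m) # ys @ zs)) + norm (\<mu> m * M (xs @ (u, m') # ys @ zs)) +
         norm ((\<mu> (m + m') - \<mu> m * \<mu> m') * M (xs @ ys @ zs))"
        unfolding e M_merge[OF V[unfolded e] ys] by (rule tri)
      also have "\<dots> \<le> K (?as, m, ?bs, m', ?cs)"
        unfolding K_def prod.case norm_mult
        by (intro add_mono mult_left_mono c d norm_ge_zero)
      also have "\<dots> \<le> sum K T" using inT T K0 by (intro member_le_sum) auto
      finally show ?thesis by simp
    qed
  qed
  thus ?case by blast
qed

section \<open>Moments of graph independent variables\<close>

lemma complex_ring_simps [simp]:
  "carrier complex_ring = UNIV" "\<zero>\<^bsub>complex_ring\<^esub> = 0" "\<one>\<^bsub>complex_ring\<^esub> = 1"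
  "a \<oplus>\<^bsub>complex_ring\<^esub> b = a + b" "a \<otimes>\<^bsub>complex_ring\<^esub> b = a * b"
  by (simp_all add: ring_of_type_algebra_def)

definition centered_pow :: "('a, 'b) nc_space_scheme \<Rightarrow> 'a \<Rightarrow> nat \<Rightarrow> 'a" where
  "centered_pow A x m =
    x [^]\<^bsub>A\<^esub> m \<oplus>\<^bsub>A\<^esub> (- state A (x [^]\<^bsub>A\<^esub> m)) \<odot>\<^bsub>A\<^esub> \<one>\<^bsub>A\<^esub>"

definition list_prod :: "('a, 'b) nc_space_scheme \<Rightarrow> 'a list \<Rightarrow> 'a" where
  "list_prod A xs = foldr (\<otimes>\<^bsub>A\<^esub>) xs \<one>\<^bsub>A\<^esub>"

lemma ordered_prod_nth: "ordered_prod A (length ws) (\<lambda>j. f (ws ! (j - 1))) = list_prod A (map f ws)"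
proof -
  have "map (\<lambda>j. f (ws ! (j - 1))) [1..<length ws + 1] = map f ws"
    by (rule nth_equalityI) (auto simp del: upt_Suc)
  thus ?thesis by (simp only: ordered_prod_def list_prod_def)
qed

context nc_prob_space
begin

lemma scale_closed [simp, intro]: "x \<in> carrier A \<Longrightarrow> c \<odot> x \<in> carrier A"
  using smult_closed[of c x] by simp

lemma list_prod_Nil [simp]: "list_prod A [] = \<one>"
  and list_prod_Cons [simp]: "list_prod A (x # xs) = x \<otimes> list_prod A xs"
  by (simp_all add: list_prod_def)

lemma list_prod_closed [simp]: "set xs \<subseteq> carrier A \<Longrightarrow> list_prod A xs \<in> carrier A"
  by (induction xs) auto

lemma list_prod_append:
  "set xs \<subseteq> carrier A \<Longrightarrow> set ys \<subseteq> carrier A \<Longrightarrow>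
    list_prod A (xs @ ys) = list_prod A xs \<otimes> list_prod A ys"
  by (induction xs) (auto simp: m_assoc)

lemma list_prod_commute:
  assumes "x \<in> carrier A" "set ys \<subseteq> carrier A" "\<forall>y\<in>set ys. x \<otimes> y = y \<otimes> x"
  shows "x \<otimes> list_prod A ys = list_prod A ys \<otimes> x"
  using assms(2,3)
proof (induction ys)
  case Nil
  thus ?case using assms(1) by simp
next
  case (Cons y ys)
  have "x \<otimes> (y \<otimes> list_prod A ys) = (y \<otimes> x) \<otimes> list_prod A ys"
    using Cons.prems assms(1) by (simp flip: m_assoc)
  also have "\<dots> = y \<otimes> (list_prod A ys \<otimes> x)" using Cons assms(1) by (simp add: m_assoc)
  also have "\<dots> = (y \<otimes> list_prod A ys) \<otimes> x" using Cons.prems assms(1) by (simp add: m_assoc)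
  finally show ?case by simp
qed

lemma state_mult_add:
  assumes "p \<in> carrier A" "q \<in> carrier A" "y \<in> carrier A" "z \<in> carrier A"
  shows "state A (p \<otimes> ((y \<oplus> z) \<otimes> q)) = state A (p \<otimes> (y \<otimes> q)) + state A (p \<otimes> (z \<otimes> q))"
  using assms by (simp add: l_distr r_distr state_add)

lemma state_mult_smult:
  assumes "p \<in> carrier A" "q \<in> carrier A" "y \<in> carrier A"
  shows "state A (p \<otimes> ((c \<odot> y) \<otimes> q)) = c * state A (p \<otimes> (y \<otimes> q))"
  using assms by (simp add: smult_mult_left smult_mult_right state_smult)

lemma centered_pow_closed [simp]: "x \<in> carrier A \<Longrightarrow> centered_pow A x m \<in> carrier A"
  by (simp add: centered_pow_def)

lemma centered_centered_pow: "x \<in> carrier A \<Longrightarrow> centered A (centered_pow A x m)"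
  by (simp add: centered_def centered_pow_def state_add state_smult state_one)

lemma centered_pow_in_generated:
  assumes "x \<in> carrier A"
  shows "centered_pow A x m \<in> generated_subalgebra A x"
  unfolding generated_subalgebra_def
proof
  fix H assume "H \<in> {H. unital_subalgebra A H \<and> x \<in> H}"
  hence sr: "subring H A" and sm: "submodule H complex_ring A" and x: "x \<in> H"
    by (auto simp: unital_subalgebra_def)
  have "x [^] m \<in> H"
    by (induction m) (use x in \<open>auto intro: subringE(3,6)[OF sr]\<close>)
  moreover have "c \<odot> \<one> \<in> H" for c
    using submodule.smult_closed[OF sm, of c \<one>] subringE(3)[OF sr] by simp
  ultimately show "centered_pow A x m \<in> H"
    unfolding centered_pow_def using subringE(7)[OF sr] by blast
qed

lemma state_centered_pow:
  assumes "p \<in> carrier A" "q \<in> carrier A" "x \<in> carrier A"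
  shows "state A (p \<otimes> (centered_pow A x m \<otimes> q)) =
    state A (p \<otimes> (x [^] m \<otimes> q)) - state A (x [^] m) * state A (p \<otimes> q)"
  using assms by (simp add: centered_pow_def state_mult_add state_mult_smult)

text \<open>Expand both factors, multiply the powers of x and centre the results again; the leftover
  multiples of the unit add up to the last coefficient. The factors p and q let the identity act in
  the middle of a word.\<close>

lemma state_centered_pow_mult:
  assumes p: "p \<in> carrier A" and q: "q \<in> carrier A" and x: "x \<in> carrier A"
  defines "\<mu> \<equiv> \<lambda>m. state A (x [^] m)"
  shows "state A (p \<otimes> (centered_pow A x m \<otimes> (centered_pow A x m' \<otimes> q))) =
    state A (p \<otimes> (centered_pow A x (m + m') \<otimes> q)) - \<mu> m' * state A (p \<otimes> (centered_pow A x m \<otimes> q))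
    - \<mu> m * state A (p \<otimes> (centered_pow A x m' \<otimes> q)) + (\<mu> (m + m') - \<mu> m * \<mu> m') * state A (p \<otimes> q)"
proof -
  have \<mu>': "state A (x [^] k) = \<mu> k" for k :: nat by (simp add: \<mu>_def)
  have 1: "state A (p \<otimes> (x [^] m \<otimes> (centered_pow A x m' \<otimes> q))) =
      state A (p \<otimes> (x [^] (m + m') \<otimes> q)) - \<mu> m' * state A (p \<otimes> (x [^] m \<otimes> q))"
    using state_centered_pow[of "p \<otimes> x [^] m" q x m'] p q x
    by (simp add: \<mu>_def m_assoc flip: nat_pow_mult)
  show ?thesis
    using p q x 1 by (simp add: state_centered_pow \<mu>' algebra_simps)
qed

text \<open>All use of graph independence is concentrated here: arcs supply the commutation behind
  \<open>M_merge\<close>, and the vanishing clause for separated words supplies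
  \<open>M_reduced\<close>. Past this point only the graph and the common moments matter.\<close>

theorem graph_moments:
  fixes g :: "'v pair_pre_digraph"
  assumes g: "pair_graph g" and ind: "g_independent A g x"
    and x: "\<And>v. v \<in> pverts g \<Longrightarrow> x v \<in> carrier A"
    and \<mu>: "\<And>v m. v \<in> pverts g \<Longrightarrow> state A (x v [^] m) = \<mu> m"
  shows "graph_moments (pverts g) (parcs g) \<mu>
    (\<lambda>ws. state A (list_prod A (map (\<lambda>(v, m). centered_pow A (x v) m) ws)))"
proof
  let ?b = "\<lambda>(v, m). centered_pow A (x v) m"
  interpret pair_graph g by fact
  show "(v, u) \<in> parcs g" if "(u, v) \<in> parcs g" for u v
    using that by (simp add: arcs_symmetric)
  show "(u, u) \<notin> parcs g" for u using no_loops by force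
  show "state A (list_prod A (map ?b [])) = 1" by (simp add: state_one)
next
  fix xs ys zs :: "('v \<times> nat) list" and u m m'
  let ?b = "\<lambda>(v, m). centered_pow A (x v) m"
  assume V: "fst ` set (xs @ (u, m) # ys @ (u, m') # zs) \<subseteq> pverts g"
    and ys: "\<forall>d\<in>set ys. (u, fst d) \<in> parcs g"
  have c: "set (map ?b ws) \<subseteq> carrier A" if "fst ` set ws \<subseteq> pverts g" for ws
    using that x by (auto simp: image_subset_iff split_beta)
  have V': "fst ` set xs \<subseteq> pverts g" "fst ` set ys \<subseteq> pverts g" "fst ` set zs \<subseteq> pverts g" "u \<in> pverts g"
    using V by auto
  let ?p = "list_prod A (map ?b xs)" and ?y = "list_prod A (map ?b ys)" and ?z = "list_prod A (map ?b zs)"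
  let ?q = "?y \<otimes> ?z" and ?B = "centered_pow A (x u)"
  note cl = c[OF V'(1)] c[OF V'(2)] c[OF V'(3)] 
  have xu: "x u \<in> carrier A" using x V' by blast
  \<comment> \<open>The letters between the two copies of u belong to algebras of neighbours of u,
    so the second copy can be moved next to the first.\<close>
  have yc: "?B k \<otimes> ?y = ?y \<otimes> ?B k" for k
  proof (rule list_prod_commute)
    show "\<forall>y\<in>set (map ?b ys). ?B k \<otimes> y = y \<otimes> ?B k"
    proof
      fix y assume "y \<in> set (map ?b ys)"
      then obtain v j where y: "y = ?B k \<or> y = centered_pow A (x v) j" "(v, j) \<in> set ys"
        "y = centered_pow A (x v) j" by auto
      have arc: "(u, v) \<in> parcs g" and v: "v \<in> pverts g" using y(2) ys V' by force+
      have "classically_independent A (generated_subalgebra A (x u)) (generated_subalgebra A (x v))"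
        using ind arc by (auto simp: g_independent_def g_independent_subalgebras_def)
      thus "?B k \<otimes> y = y \<otimes> ?B k"
        using centered_pow_in_generated xu x[OF v] unfolding y(3) classically_independent_def by blast
    qed
  qed (use xu cl in auto)
  have e1: "list_prod A (map ?b (xs @ (u, k) # ys @ zs)) = ?p \<otimes> (?B k \<otimes> ?q)" for k
    using cl xu by (simp add: list_prod_append)
  have e2: "list_prod A (map ?b (xs @ (u, m) # ys @ (u, m') # zs)) = ?p \<otimes> (?B m \<otimes> (?B m' \<otimes> ?q))"
  proof -
    have "?y \<otimes> (?B m' \<otimes> ?z) = ?B m' \<otimes> ?q"
      using cl xu yc[of m'] by (metis centered_pow_closed list_prod_closed m_assoc)
    thus ?thesis using cl xu by (simp add: list_prod_append)
  qed
  have e3: "list_prod A (map ?b (xs @ ys @ zs)) = ?p \<otimes> ?q" using cl by (simp add: list_prod_append)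
  show "state A (list_prod A (map ?b (xs @ (u, m) # ys @ (u, m') # zs))) =
      state A (list_prod A (map ?b (xs @ (u, m + m') # ys @ zs)))
      - \<mu> m' * state A (list_prod A (map ?b (xs @ (u, m) # ys @ zs)))
      - \<mu> m * state A (list_prod A (map ?b (xs @ (u, m') # ys @ zs)))
      + (\<mu> (m + m') - \<mu> m * \<mu> m') * state A (list_prod A (map ?b (xs @ ys @ zs)))"
    unfolding e1 e2 e3
    using state_centered_pow_mult[of ?p ?q "x u" m m'] cl xu by (simp add: \<mu>[OF V'(4)])
next
  fix ws
  let ?b = "\<lambda>(v, m). centered_pow A (x v) m"
  assume V: "fst ` set ws \<subseteq> pverts g" and ne: "ws \<noteq> []" and nm: "\<not> mergeable (parcs g) ws"
  let ?i = "\<lambda>j. fst (ws ! (j - 1))"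
  let ?k = "length ws"
  have mem: "ws ! (j - 1) \<in> set ws" if "j \<in> {1..?k}" for j using that by auto
  \<comment> \<open>If every letter strictly between positions j1 and j2 were a neighbour of their
    common vertex, the word would split as in \<open>mergeable\<close>. Positions count from 1 and
    list indices from 0, hence the shifts.\<close>
  have sep: "\<exists>j3. j1 < j3 \<and> j3 < j2 \<and> (?i j1, ?i j3) \<notin> parcs g"
    if j: "j1 \<in> {1..?k}" "j2 \<in> {1..?k}" "j1 < j2" "?i j1 = ?i j2" for j1 j2
  proof (rule ccontr)
    assume no: "\<not> ?thesis"
    let ?xs = "take (j1 - 1) ws" and ?ys = "drop j1 (take (j2 - 1) ws)" and ?zs = "drop j2 ws"
    have "ws = take (j2 - 1) ws @ ws ! (j2 - 1) # ?zs"
      using id_take_nth_drop[of "j2 - 1" ws] j by auto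
    moreover have "take (j2 - 1) ws = ?xs @ ws ! (j1 - 1) # ?ys"
    proof -
      have "j1 - 1 < length (take (j2 - 1) ws)" "Suc (j1 - 1) = j1" "min (j1 - 1) (j2 - 1) = j1 - 1"
        using j by auto
      thus ?thesis
        using id_take_nth_drop[of "j1 - 1" "take (j2 - 1) ws"] by (simp add: take_take)
    qed
    ultimately have "ws = ?xs @ (?i j1, snd (ws ! (j1 - 1))) # ?ys @ (?i j1, snd (ws ! (j2 - 1))) # ?zs"
      using j(4) by (metis append_Cons append_assoc prod.collapse)
    moreover have "(?i j1, fst d) \<in> parcs g" if d: "d \<in> set ?ys" for d
    proof -
      obtain t where t: "t < length ?ys" "d = ?ys ! t" using d by (metis in_set_conv_nth)
      hence "d = ws ! (j1 + t)" "j1 + t < j2 - 1" using j by auto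
      thus ?thesis using no by (metis add_diff_cancel_right' add.commute less_add_Suc1 less_diff_conv plus_1_eq_Suc)
    qed
    ultimately show False using nm unfolding mergeable_def by blast
  qed
  have "state A (ordered_prod A ?k (\<lambda>j. ?b (ws ! (j - 1)))) = 0"
  proof -
    have "\<forall>i :: nat \<Rightarrow> _. \<forall>y :: nat \<Rightarrow> _. (\<forall>j\<in>{1..?k}. i j \<in> pverts g) \<longrightarrow>
        (\<forall>j1\<in>{1..?k}. \<forall>j2\<in>{1..?k}. j1 < j2 \<and> i j1 = i j2 \<longrightarrow>
           (\<exists>j3. j1 < j3 \<and> j3 < j2 \<and> (i j1, i j3) \<notin> parcs g)) \<longrightarrow>
        (\<forall>j\<in>{1..?k}. y j \<in> generated_subalgebra A (x (i j)) \<and> centered A (y j)) \<longrightarrow>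
        state A (ordered_prod A ?k y) = 0"
      using ind ne unfolding g_independent_def g_independent_subalgebras_def
      by (simp add: Suc_le_eq)
    note this[rule_format, of ?i "\<lambda>j. ?b (ws ! (j - 1))"]
    moreover have "?i j \<in> pverts g" if "j \<in> {1..?k}" for j using mem[OF that] V by blast
    moreover have "?b (ws ! (j - 1)) \<in> generated_subalgebra A (x (?i j)) \<and> centered A (?b (ws ! (j - 1)))"
      if "j \<in> {1..?k}" for j
      using mem[OF that] V x centered_pow_in_generated centered_centered_pow
      by (auto simp: split_beta)
    ultimately show ?thesis using sep by blast
  qed
  thus "state A (list_prod A (map ?b ws)) = 0" by (simp only: ordered_prod_nth)
qed

end

section \<open>Homomorphism densities\<close>

lemma prob_space_unit_interval: "prob_space (restrict_space lborel {0..1::real})"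
  by (rule prob_spaceI) (simp add: emeasure_restrict_space space_restrict_space)

text \<open>A measure preserving map pulls null sets back to null sets, so it stays measurable and
  measure preserving between the completions.\<close>

lemma completion_PiM_reindex:
  assumes M: "prob_space M" and f: "inj_on f I"
  defines "T \<equiv> \<lambda>\<omega>. \<lambda>i\<in>I. \<omega> (f i)"
  shows "T \<in> completion (\<Pi>\<^sub>M j\<in>f ` I. M) \<rightarrow>\<^sub>M completion (\<Pi>\<^sub>M i\<in>I. M)"
    and "distr (completion (\<Pi>\<^sub>M j\<in>f ` I. M)) (completion (\<Pi>\<^sub>M i\<in>I. M)) T = completion (\<Pi>\<^sub>M i\<in>I. M)"
proof -
  let ?P = "\<Pi>\<^sub>M j\<in>f ` I. M" and ?Q = "\<Pi>\<^sub>M i\<in>I. M"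
  have T: "T \<in> ?P \<rightarrow>\<^sub>M ?Q"
    unfolding T_def by (intro measurable_restrict measurable_component_singleton) auto
  have "distr ?P ?Q T = ?Q"
    unfolding T_def using distr_PiM_reindex[of "f ` I" "\<lambda>_. M" f I] M f by auto
  hence d: "distr (completion ?P) ?Q T = ?Q" using distr_completion[OF T] by simp
  have T': "T \<in> completion ?P \<rightarrow>\<^sub>M ?Q" using T by (rule measurable_completion)
  show "T \<in> completion ?P \<rightarrow>\<^sub>M completion ?Q"
    using completion.measurable_completion2[OF T'] d by simp
  show "distr (completion ?P) (completion ?Q) T = completion ?Q"
    using completion.completion_distr_eq[OF T'] d by simp
qed

text \<open>Here \<open>h\<close> is arbitrary, so a change of variables alone does not suffice. If
  \<open>h\<close> is not measurable, neither is its relabelled version, since the inverse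
  relabelling would carry measurability back; both integrals are then 0 by convention.\<close>

lemma integral_completion_PiM_reindex:
  fixes h :: "_ \<Rightarrow> real"
  assumes M: "prob_space M" and f: "inj_on f I"
  shows "(\<integral>x. h (\<lambda>i\<in>I. x (f i)) \<partial>completion (\<Pi>\<^sub>M j\<in>f ` I. M)) = (\<integral>x. h x \<partial>completion (\<Pi>\<^sub>M i\<in>I. M))"
proof -
  let ?P = "completion (\<Pi>\<^sub>M j\<in>f ` I. M)" and ?Q = "completion (\<Pi>\<^sub>M i\<in>I. M)"
  let ?T = "\<lambda>\<omega>. \<lambda>i\<in>I. \<omega> (f i)" and ?f' = "inv_into I f"
  let ?T' = "\<lambda>\<omega>. \<lambda>j\<in>f ` I. \<omega> (?f' j)"
  note T = completion_PiM_reindex[OF M f]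
  have "?f' ` f ` I = I" using f by simp
  hence T': "?T' \<in> ?Q \<rightarrow>\<^sub>M ?P"
    using completion_PiM_reindex(1)[OF M, of ?f' "f ` I"] by (simp add: inj_on_inv_into)
  show ?thesis
  proof (cases "h \<in> borel_measurable ?Q")
    case True
    show ?thesis using integral_distr[OF T(1) True] T(2) by simp
  next
    case False
    have "(\<lambda>x. h (?T x)) \<notin> borel_measurable ?P"
    proof
      assume "(\<lambda>x. h (?T x)) \<in> borel_measurable ?P"
      hence "(\<lambda>x. h (?T (?T' x))) \<in> borel_measurable ?Q" by (rule measurable_compose[OF T'])
      also have "?this \<longleftrightarrow> h \<in> borel_measurable ?Q"
      proof (rule measurable_cong)
        fix x assume "x \<in> space ?Q"
        hence "x \<in> extensional I" by (simp add: space_PiM PiE_def)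
        hence "?T (?T' x) = x" using f by (auto simp: extensional_def fun_eq_iff)
        thus "h (?T (?T' x)) = h x" by simp
      qed
      finally show False using False by contradiction
    qed
    hence "\<not> integrable ?P (\<lambda>x. h (?T x))" "\<not> integrable ?Q h"
      using False by (auto dest: borel_measurable_integrable)
    thus ?thesis by (simp add: not_integrable_integral_eq)
  qed
qed

text \<open>Relabelling the coordinates is an isomorphism of the completed measure spaces; if the
  integrand is not integrable, both densities take the junk value \<open>0\<close>.\<close>

lemma hom_density_relabel:
  assumes f: "inj_on f (pverts (underlying F))"
    and V: "pverts (underlying G) = f ` pverts (underlying F)"
    and D: "oriented_edges F \<subseteq> pverts (underlying F) \<times> pverts (underlying F)"
      "oriented_edges G = map_prod f f ` oriented_edges F"
    and dec: "\<And>u v. (u, v) \<in> oriented_edges F \<Longrightarrow> decoration G (f u, f v) = decoration F (u, v)"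
  shows "hom_density G w = hom_density F w"
proof -
  let ?V = "pverts (underlying F)"
  let ?h = "\<lambda>x. \<Prod>(u, v)\<in>oriented_edges F. decoration F (u, v) \<bullet> w (x u) (x v)"
  have "inj_on (map_prod f f) (oriented_edges F)"
    using map_prod_inj_on[OF f f] D(1) by (rule inj_on_subset)
  hence "(\<Prod>(u, v)\<in>oriented_edges G. decoration G (u, v) \<bullet> w (x u) (x v)) = ?h (\<lambda>i\<in>?V. x (f i))" for x
    unfolding D(2) using dec D(1) by (subst prod.reindex) (auto intro!: prod.cong)
  thus ?thesis
    using integral_completion_PiM_reindex[OF prob_space_unit_interval f, of ?h]
    by (simp add: hom_density_def V)
qed

text \<open>The index of the interval of the block graphon that contains \<open>t\<close>; it is \<open>n + 1\<close> at \<open>t = 1\<close>.\<close>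

definition cell :: "nat \<Rightarrow> real \<Rightarrow> nat" where
  "cell n t = nat \<lfloor>real n * t\<rfloor> + 1"

lemma cell_eq_iff:
  assumes "n \<ge> 1" "t \<ge> 0" "k \<ge> 1"
  shows "t \<in> {(real k - 1) / real n..<real k / real n} \<longleftrightarrow> cell n t = k"
proof -
  have "t \<in> {(real k - 1) / real n..<real k / real n} \<longleftrightarrow>
      real k - 1 \<le> real n * t \<and> real n * t < real k"
    using assms(1) by (simp add: field_simps)
  also have "\<dots> \<longleftrightarrow> \<lfloor>real n * t\<rfloor> = int k - 1" by (simp add: floor_eq_iff)
  also have "\<dots> \<longleftrightarrow> cell n t = k"
    using assms by (auto simp: cell_def nat_eq_iff)
  finally show ?thesis .
qed

lemma cell_bounds: "n \<ge> 1 \<Longrightarrow> t \<in> {0..1} \<Longrightarrow> cell n t \<in> {1..n + 1}"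
proof -
  assume "n \<ge> 1" "t \<in> {0..1}"
  hence "real n * t \<le> real n" by (simp add: mult_left_le)
  hence "\<lfloor>real n * t\<rfloor> \<le> int n" by (simp add: floor_le_iff)
  thus ?thesis by (simp add: cell_def)
qed

text \<open>The identity includes the endpoint 1: none of the half-open intervals contains it, and
  its index n + 1 is not the first coordinate of any arc, so both sides are 0.\<close>

lemma block_graphon_cell:
  fixes g :: "(nat \<times> 'l::finite) pair_pre_digraph"
  assumes n: "n \<ge> 1" and g: "parcs g \<subseteq> ({1..n} \<times> UNIV) \<times> ({1..n} \<times> UNIV)"
    and s: "s \<in> {0..1}" and t: "t \<in> {0..1}"
  shows "block_graphon n g s t = block_decoration g (cell n s) (cell n t)"
proof -
  have "block_graphon n g s t =
    (\<Sum>u\<in>{1..n}. \<Sum>v\<in>{1..n}. if u = cell n s then (if v = cell n t then block_decoration g u v else 0) else 0)"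
    unfolding block_graphon_def
  proof (intro sum.cong refl)
    fix u v assume "u \<in> {1..n}" "v \<in> {1..n}"
    hence "s \<in> {(real u - 1) / real n..<real u / real n} \<longleftrightarrow> cell n s = u"
      "t \<in> {(real v - 1) / real n..<real v / real n} \<longleftrightarrow> cell n t = v"
      using cell_eq_iff[OF n] s t by auto
    thus "(indicator {(real u - 1) / real n..<real u / real n} s *
         indicator {(real v - 1) / real n..<real v / real n} t) *\<^sub>R block_decoration g u v =
        (if u = cell n s then (if v = cell n t then block_decoration g u v else 0) else 0)"
      by (auto simp: indicator_def)
  qed
  also have "\<dots> = (if cell n s \<in> {1..n} \<and> cell n t \<in> {1..n} then block_decoration g (cell n s) (cell n t) else 0)"
  proof -
    have "(\<Sum>v\<in>{1..n}. if P then (if v = cell n t then y v else 0) else 0) =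
        (if P then if cell n t \<in> {1..n} then y (cell n t) else 0 else 0)" for P and y :: "nat \<Rightarrow> real^'l^'l"
      by (cases P) (simp_all add: sum.delta)
    thus ?thesis by (simp add: sum.delta)
  qed
  also have "\<dots> = block_decoration g (cell n s) (cell n t)"
  proof -
    have "block_decoration g u v = 0" if "\<not> (u \<in> {1..n} \<and> v \<in> {1..n})" for u v
    proof -
      have "((u, i), (v, j)) \<notin> parcs g" for i j using g that by auto
      thus ?thesis by (simp add: block_decoration_def vec_eq_iff)
    qed
    thus ?thesis by auto
  qed
  finally show ?thesis .
qed

lemma integral_cell:
  assumes n: "n \<ge> 1" and k: "k \<in> {1..n + 1}"
  shows "(\<integral>t. indicator {(real k - 1) / real n..<real k / real n} t \<partial>restrict_space lborel {0..1}) =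
    (if k \<le> n then 1 / real n else 0)"
proof -
  let ?A = "{(real k - 1) / real n..<real k / real n}"
  have "(\<integral>t. indicator ?A t \<partial>restrict_space lborel {0..1}) = measure lborel (?A \<inter> {0..1})"
    by (simp add: measure_restrict_space space_restrict_space)
  also have "\<dots> = (if k \<le> n then 1 / real n else 0)"
  proof (cases "k \<le> n")
    case True
    have "0 \<le> (real k - 1) / real n" using k n by (simp add: field_simps)
    moreover have "real k / real n \<le> 1" using True n by (simp add: field_simps)
    ultimately have "?A \<inter> {0..1} = ?A" by auto
    thus ?thesis using True n by (simp add: field_simps divide_right_mono)
  next
    case False
    hence "k = n + 1" using k by simp
    hence "?A \<inter> {0..1} = {1}" using n by (auto simp: field_simps)
    thus ?thesis using False by simp
  qed
  finally show ?thesis .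
qed

lemma hom_density_block_graphon:
  fixes F :: "('v, 'l::finite) dec_graph"
  defines "V \<equiv> pverts (underlying F)" and "D \<equiv> oriented_edges F"
  assumes n: "n \<ge> 1" and g: "parcs g \<subseteq> ({1..n} \<times> UNIV) \<times> ({1..n} \<times> UNIV)"
    and V: "finite V" and D: "D \<subseteq> V \<times> V"
  shows "hom_density F (block_graphon n g) =
    (\<Sum>\<kappa>\<in>V \<rightarrow>\<^sub>E {1..n}. \<Prod>(u, v)\<in>D. decoration F (u, v) \<bullet> block_decoration g (\<kappa> u) (\<kappa> v)) / real n ^ card V"
proof -
  let ?N = "restrict_space lborel {0..1::real}"
  let ?h = "\<lambda>\<kappa>. \<Prod>(u, v)\<in>D. decoration F (u, v) \<bullet> block_decoration g (\<kappa> u) (\<kappa> v)"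
  let ?I = "\<lambda>k. {(real k - 1) / real n..<real k / real n}"
  let ?f = "\<lambda>x. \<Sum>\<kappa>\<in>V \<rightarrow>\<^sub>E {1..n + 1}. ?h \<kappa> * (\<Prod>v\<in>V. indicator (?I (\<kappa> v)) (x v))"
  let ?P = "\<Pi>\<^sub>M v\<in>V. ?N"
  interpret N: prob_space ?N by (rule prob_space_unit_interval)
  interpret product_sigma_finite "\<lambda>_ :: 'v. ?N" by standard
  have fin: "finite (V \<rightarrow>\<^sub>E {1..m})" for m :: nat using V by (intro finite_PiE) auto
  have int1: "integrable ?N (indicator (?I k) :: real \<Rightarrow> real)" for k
    by (rule N.integrable_const_bound[of _ 1]) (auto intro!: measurable_restrict_space1)
  have int: "integrable ?P (\<lambda>x. \<Prod>v\<in>V. indicator (?I (\<kappa> v)) (x v) :: real)" for \<kappa>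
    using int1 V by (intro product_integrable_prod)
  have eq: "(\<Prod>(u, v)\<in>D. decoration F (u, v) \<bullet> block_graphon n g (x u) (x v)) = ?f x"
    if x: "x \<in> space ?P" for x
  proof -
    let ?k = "\<lambda>v\<in>V. cell n (x v)"
    have x01: "x v \<in> {0..1}" if "v \<in> V" for v
      using x that by (auto simp: space_PiM space_restrict_space)
    have "(\<Prod>(u, v)\<in>D. decoration F (u, v) \<bullet> block_graphon n g (x u) (x v)) = ?h ?k"
      using D x01 by (intro prod.cong refl) (auto simp: block_graphon_cell[OF n g])
    also have "\<dots> = (\<Sum>\<kappa>\<in>V \<rightarrow>\<^sub>E {1..n + 1}. if \<kappa> = ?k then ?h \<kappa> else 0)"
    proof -
      have "?k \<in> V \<rightarrow>\<^sub>E {1..n + 1}" using cell_bounds[OF n] x01 by (intro restrict_PiE_iff[THEN iffD2]) blast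
      thus ?thesis using fin by (simp add: sum.delta)
    qed
    also have "\<dots> = ?f x"
    proof (rule sum.cong)
      fix \<kappa> assume k: "\<kappa> \<in> V \<rightarrow>\<^sub>E {1..n + 1}"
      have "(\<Prod>v\<in>V. indicator (?I (\<kappa> v)) (x v) :: real) = (\<Prod>v\<in>V. of_bool (cell n (x v) = \<kappa> v))"
      proof (rule prod.cong)
        fix v assume v: "v \<in> V"
        hence "\<kappa> v \<ge> 1" using k by (auto dest: PiE_mem)
        thus "indicator (?I (\<kappa> v)) (x v) = (of_bool (cell n (x v) = \<kappa> v) :: real)"
          using cell_eq_iff[OF n, of "x v" "\<kappa> v"] x01[OF v] by (auto simp: indicator_def)
      qed simp
      also have "\<dots> = of_bool (\<forall>v\<in>V. cell n (x v) = \<kappa> v)" using V by (induction V) auto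
      also have "(\<forall>v\<in>V. cell n (x v) = \<kappa> v) \<longleftrightarrow> \<kappa> = ?k"
        using k by (auto simp: PiE_def extensional_def fun_eq_iff)
      finally show "(if \<kappa> = ?k then ?h \<kappa> else 0) = ?h \<kappa> * (\<Prod>v\<in>V. indicator (?I (\<kappa> v)) (x v))"
        by simp
    qed simp
    finally show ?thesis .
  qed
  have "hom_density F (block_graphon n g) = (\<integral>x. ?f x \<partial>completion ?P)"
    unfolding hom_density_def V_def[symmetric] D_def[symmetric]
    by (rule Bochner_Integration.integral_cong) (simp_all only: space_completion eq)
  \<comment> \<open>The step function is measurable for the product measure itself, so the
    completion can be removed.\<close>
  also have "\<dots> = (\<integral>x. ?f x \<partial>?P)"
    using int by (intro integral_completion borel_measurable_integrable)
      (auto intro!: Bochner_Integration.integrable_sum)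
  also have "\<dots> = (\<Sum>\<kappa>\<in>V \<rightarrow>\<^sub>E {1..n + 1}. ?h \<kappa> * (\<Prod>v\<in>V. if \<kappa> v \<le> n then 1 / real n else 0))"
  proof -
    have "(\<integral>x. (\<Prod>v\<in>V. indicator (?I (\<kappa> v)) (x v)) \<partial>?P) = (\<Prod>v\<in>V. if \<kappa> v \<le> n then 1 / real n else 0)"
      if k: "\<kappa> \<in> V \<rightarrow>\<^sub>E {1..n + 1}" for \<kappa>
    proof -
      have "(\<integral>x. (\<Prod>v\<in>V. indicator (?I (\<kappa> v)) (x v)) \<partial>?P) = (\<Prod>v\<in>V. \<integral>t. indicator (?I (\<kappa> v)) t \<partial>?N :: real)"
        using int1 V by (intro product_integral_prod)
      also have "\<dots> = (\<Prod>v\<in>V. if \<kappa> v \<le> n then 1 / real n else 0)"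
        using integral_cell[OF n] k by (intro prod.cong refl) (blast dest: PiE_mem)
      finally show ?thesis .
    qed
    thus ?thesis using int by (subst Bochner_Integration.integral_sum) (auto intro!: sum.cong)
  qed
  also have "\<dots> = (\<Sum>\<kappa>\<in>V \<rightarrow>\<^sub>E {1..n}. ?h \<kappa> * (\<Prod>v\<in>V. if \<kappa> v \<le> n then 1 / real n else 0))"
  proof (rule sum.mono_neutral_right[OF fin])
    show "V \<rightarrow>\<^sub>E {1..n} \<subseteq> V \<rightarrow>\<^sub>E {1..n + 1}" by (intro PiE_mono) auto
    show "\<forall>\<kappa>\<in>(V \<rightarrow>\<^sub>E {1..n + 1}) - (V \<rightarrow>\<^sub>E {1..n}).
        ?h \<kappa> * (\<Prod>v\<in>V. if \<kappa> v \<le> n then 1 / real n else 0) = 0"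
    proof
      fix \<kappa> assume k: "\<kappa> \<in> (V \<rightarrow>\<^sub>E {1..n + 1}) - (V \<rightarrow>\<^sub>E {1..n})"
      then obtain v where "v \<in> V" "\<not> \<kappa> v \<le> n" by (auto simp: PiE_iff)
      hence "(\<Prod>v\<in>V. if \<kappa> v \<le> n then 1 / real n else 0) = 0" using V by (intro prod_zero) auto
      thus "?h \<kappa> * (\<Prod>v\<in>V. if \<kappa> v \<le> n then 1 / real n else 0) = 0" by simp
    qed
  qed
  also have "\<dots> = (\<Sum>\<kappa>\<in>V \<rightarrow>\<^sub>E {1..n}. ?h \<kappa> / real n ^ card V)"
  proof (rule sum.cong)
    fix \<kappa> assume "\<kappa> \<in> V \<rightarrow>\<^sub>E {1..n}"
    hence "(\<Prod>v\<in>V. if \<kappa> v \<le> n then 1 / real n else 0) = (\<Prod>v\<in>V. 1 / real n)"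
      by (intro prod.cong) (auto dest: PiE_mem)
    thus "?h \<kappa> * (\<Prod>v\<in>V. if \<kappa> v \<le> n then 1 / real n else 0) = ?h \<kappa> / real n ^ card V"
      by (simp add: power_one_over)
  qed simp
  finally show ?thesis by (simp add: sum_divide_distrib)
qed

section \<open>Pair partitions and index tuples\<close>

lemma subseq_mapE:
  assumes "subseq xs (map f ys)"
  obtains zs where "subseq zs ys" "xs = map f zs"
  using assms
proof (induction ys arbitrary: xs thesis)
  case Nil
  have "xs = []" using Nil.prems(2) by simp
  thus ?case using Nil.prems(1)[of "[]"] by simp
next
  case (Cons y ys)
  show ?case
  proof (cases "subseq xs (map f ys)")
    case True
    then obtain zs where zs: "subseq zs ys" "xs = map f zs" using Cons.IH by blast
    have "subseq zs (y # ys)" using zs(1) by (rule list_emb_Cons)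
    thus ?thesis using Cons.prems(1) zs(2) by blast
  next
    case False
    then obtain a xs' where xs: "xs = a # xs'" by (cases xs) auto
    have a: "a = f y" "subseq xs' (map f ys)"
      using Cons.prems(2) False unfolding xs by (auto split: if_splits)
    then obtain zs where "subseq zs ys" "xs' = map f zs" using Cons.IH by blast
    thus ?thesis using Cons.prems(1)[of "y # zs"] xs a by simp
  qed
qed

lemma subseq_sorted_wrt: "subseq xs ys \<Longrightarrow> sorted_wrt P ys \<Longrightarrow> sorted_wrt P xs"
proof (induction rule: list_emb.induct)
  case (list_emb_Cons2 x y xs ys)
  thus ?case by (auto dest: list_emb_set)
qed auto

text \<open>A map with at most q values factors through {1..q}, and there are q^(card I) * n^q pairs
  of factors. If fewer than q values are taken, the second factor is padded with the value 1, which
  lies in {1..n} because n is at least 1.\<close>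

lemma card_PiE_image_le:
  fixes I :: "'i set"
  assumes I: "finite I" and n: "n \<ge> 1"
  shows "card {k \<in> I \<rightarrow>\<^sub>E {1..n}. card (k ` I) \<le> q} \<le> q ^ card I * n ^ q"
proof -
  let ?A = "I \<rightarrow>\<^sub>E {1..q}" and ?B = "{1..q} \<rightarrow>\<^sub>E {1..n}"
  let ?\<Phi> = "\<lambda>(a, b). \<lambda>i\<in>I. b (a i)"
  have fin: "finite (?A \<times> ?B)" using I by (intro finite_cartesian_product finite_PiE) auto
  have "{k \<in> I \<rightarrow>\<^sub>E {1..n}. card (k ` I) \<le> q} \<subseteq> ?\<Phi> ` (?A \<times> ?B)"
  proof
    fix k assume "k \<in> {k \<in> I \<rightarrow>\<^sub>E {1..n}. card (k ` I) \<le> q}"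
    hence k: "k \<in> I \<rightarrow>\<^sub>E {1..n}" and q: "card (k ` I) \<le> q" by auto
    obtain e where e: "bij_betw e {1..card (k ` I)} (k ` I)"
      using ex_bij_betw_nat_finite_1[of "k ` I"] I by auto
    define b where "b = (\<lambda>j\<in>{1..q}. if j \<le> card (k ` I) then e j else 1)"
    define a where "a = (\<lambda>i\<in>I. inv_into {1..card (k ` I)} e (k i))"
    have inv: "inv_into {1..card (k ` I)} e (k i) \<in> {1..card (k ` I)}"
      "e (inv_into {1..card (k ` I)} e (k i)) = k i" if "i \<in> I" for i
    proof -
      have "k i \<in> e ` {1..card (k ` I)}" using e that by (simp add: bij_betw_def)
      thus "inv_into {1..card (k ` I)} e (k i) \<in> {1..card (k ` I)}"
        "e (inv_into {1..card (k ` I)} e (k i)) = k i"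
        by (rule inv_into_into, rule f_inv_into_f)
    qed
    have "a \<in> ?A" using inv q unfolding a_def by (intro restrict_PiE_iff[THEN iffD2]) force
    moreover have "b \<in> ?B"
    proof -
      have "e j \<in> {1..n}" if "j \<in> {1..card (k ` I)}" for j
        using bij_betw_apply[OF e that] k by (auto dest: PiE_mem)
      thus ?thesis unfolding b_def using n by (intro restrict_PiE_iff[THEN iffD2]) auto
    qed
    moreover have "?\<Phi> (a, b) = k"
    proof
      fix i
      show "?\<Phi> (a, b) i = k i"
      proof (cases "i \<in> I")
        case True
        hence "a i \<in> {1..card (k ` I)}" "e (a i) = k i" using inv by (auto simp: a_def)
        thus ?thesis using True q by (simp add: b_def)
      next
        case False
        thus ?thesis using PiE_arb[OF k False] by simp
      qed
    qed
    ultimately show "k \<in> ?\<Phi> ` (?A \<times> ?B)" by (intro image_eqI[of _ _ "(a, b)"]) simp_all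
  qed
  hence "card {k \<in> I \<rightarrow>\<^sub>E {1..n}. card (k ` I) \<le> q} \<le> card (?A \<times> ?B)"
    using fin by (meson card_image_le card_mono finite_imageI le_trans)
  also have "\<dots> = q ^ card I * n ^ q" using I by (simp add: card_cartesian_product card_PiE)
  finally show ?thesis .
qed

section \<open>Blocks of pair partitions and the index tuples they label\<close>

definition block_of :: "nat set set \<Rightarrow> nat \<Rightarrow> nat set" where
  "block_of \<pi> u = \<Union>{U \<in> \<pi>. u \<in> U}"

text \<open>This is a graph homomorphism condition: the map that sends a block U to
  \<open>\<kappa> U\<close> together with the common value of l on U carries the intersection graph
  of \<pi> into the graph with arcs E.\<close>

definition compatible ::
  "((nat \<times> 'l) \<times> (nat \<times> 'l)) set \<Rightarrow> nat set set \<Rightarrow> (nat \<Rightarrow> 'l) \<Rightarrow> (nat set \<Rightarrow> nat) \<Rightarrow> bool" where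
  "compatible E \<pi> l \<kappa> \<longleftrightarrow> (\<forall>U\<in>\<pi>. \<forall>V\<in>\<pi>. U \<noteq> V \<longrightarrow> crossing U V \<longrightarrow>
     ((\<kappa> U, the_elem (l ` U)), (\<kappa> V, the_elem (l ` V))) \<in> E)"

definition index_word :: "nat \<Rightarrow> (nat \<Rightarrow> 'l) \<Rightarrow> (nat \<Rightarrow> nat) \<Rightarrow> (nat \<times> 'l) list" where
  "index_word p l k = map (\<lambda>u. (k u, l u)) [1..<p + 1]"

lemma count_list_index_word:
  "count_list (index_word p l k) v = card {u \<in> {1..p}. (k u, l u) = v}"
proof -
  have "count_list (index_word p l k) v = length (filter (\<lambda>u. (k u, l u) = v) [1..<p + 1])"
    unfolding index_word_def count_list_eq_length_filter filter_map
    by (simp only: length_map comp_def) (metis (no_types, lifting))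
  also have "\<dots> = card (set (filter (\<lambda>u. (k u, l u) = v) [1..<p + 1]))"
    by (rule distinct_card[symmetric]) (simp del: upt_Suc)
  also have "set (filter (\<lambda>u. (k u, l u) = v) [1..<p + 1]) = {u \<in> {1..p}. (k u, l u) = v}"
    by (auto simp del: upt_Suc)
  finally show ?thesis .
qed

lemma pair_partitions_finite: "finite (pair_partitions p)"
proof (rule finite_subset)
  show "pair_partitions p \<subseteq> Pow (Pow {1..p})"
    unfolding pair_partitions_def partition_on_def by auto
qed simp

context
  fixes p \<pi> assumes \<pi>: "\<pi> \<in> pair_partitions p"
begin

lemma pair_partition_finite: "finite \<pi>"
  using \<pi> finite_elements[of "{1..p}" \<pi>] by (auto simp: pair_partitions_def)

lemma pair_partition_block: "U \<in> \<pi> \<Longrightarrow> U \<subseteq> {1..p} \<and> card U = 2"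
  using \<pi> by (auto simp: pair_partitions_def partition_on_def)

lemma pair_partition_card: "p = 2 * card \<pi>"
proof -
  have "card {1..p} = (\<Sum>U\<in>\<pi>. card U)"
  proof (rule product_partition)
    show "partition_on {1..p} \<pi>" using \<pi> by (simp add: pair_partitions_def)
    show "finite U" if "U \<in> \<pi>" for U
      using pair_partition_block[OF that] finite_subset[of U "{1..p}"] by simp
  qed
  also have "\<dots> = 2 * card \<pi>" using pair_partition_block by simp
  finally show ?thesis by simp
qed

lemma block_of_eq: "U \<in> \<pi> \<Longrightarrow> u \<in> U \<Longrightarrow> block_of \<pi> u = U"
proof -
  assume U: "U \<in> \<pi>" "u \<in> U"
  have "{V \<in> \<pi>. u \<in> V} = {U}"
    using \<pi> U by (auto simp: pair_partitions_def partition_on_def disjoint_def)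
  thus ?thesis by (simp add: block_of_def)
qed

lemma block_of_mem: "u \<in> {1..p} \<Longrightarrow> block_of \<pi> u \<in> \<pi> \<and> u \<in> block_of \<pi> u"
proof -
  assume "u \<in> {1..p}"
  moreover have "\<Union> \<pi> = {1..p}" using \<pi> by (simp add: pair_partitions_def partition_on_def)
  ultimately obtain U where "U \<in> \<pi>" "u \<in> U" by blast
  thus ?thesis using block_of_eq by auto
qed

end

lemma le_ker_block:
  assumes "le_ker \<pi> l" "U \<in> \<pi>" "u \<in> U"
  shows "the_elem (l ` U) = l u"
proof -
  have "l ` U = {l u}" using assms unfolding le_ker_def by blast
  thus ?thesis by simp
qed

text \<open>The pair partition is recovered as the set of fibres of the index tuple.\<close>

lemma bij_betw_pair_indices:
  fixes n p :: nat
  shows "bij_betw (\<lambda>(\<pi>, \<kappa>). \<lambda>u\<in>{1..p}. \<kappa> (block_of \<pi> u))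
    (SIGMA \<pi>:pair_partitions p. {\<kappa> \<in> \<pi> \<rightarrow>\<^sub>E {1..n}. inj_on \<kappa> \<pi>})
    {k \<in> {1..p} \<rightarrow>\<^sub>E {1..n}. \<forall>u\<in>{1..p}. card {u' \<in> {1..p}. k u' = k u} = 2}"
    (is "bij_betw ?\<Phi> ?A ?B")
proof -
  define cls where "cls = (\<lambda>k (v::nat). {u' \<in> {1..p}. k u' = v})"
  let ?\<Psi> = "\<lambda>k. let \<pi> = cls k ` k ` {1..p} in (\<pi>, \<lambda>U\<in>\<pi>. the_elem (k ` U))"
  \<comment> \<open>Injectivity of \<kappa> on \<pi> keeps different blocks in different fibres;
    otherwise a fibre could be a union of several blocks.\<close>
  have fib: "{u' \<in> {1..p}. ?\<Phi> (\<pi>, \<kappa>) u' = \<kappa> U} = U"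
    if "\<pi> \<in> pair_partitions p" "inj_on \<kappa> \<pi>" "U \<in> \<pi>" for \<pi> \<kappa> U
  proof -
    note b = block_of_mem[OF that(1)] block_of_eq[OF that(1)] pair_partition_block[OF that(1)]
    show ?thesis
    proof (rule equalityI; rule subsetI)
      fix u assume "u \<in> {u' \<in> {1..p}. ?\<Phi> (\<pi>, \<kappa>) u' = \<kappa> U}"
      hence "u \<in> {1..p}" "\<kappa> (block_of \<pi> u) = \<kappa> U" by auto
      thus "u \<in> U" using b(1)[of u] that by (metis inj_onD)
    next
      fix u assume "u \<in> U"
      thus "u \<in> {u' \<in> {1..p}. ?\<Phi> (\<pi>, \<kappa>) u' = \<kappa> U}" using b(2,3)[OF that(3)] by auto
    qed
  qed
  have img: "\<exists>u\<in>U. u \<in> {1..p} \<and> ?\<Phi> (\<pi>, \<kappa>) u = \<kappa> U" if "\<pi> \<in> pair_partitions p" "U \<in> \<pi>" for \<pi> \<kappa> U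
  proof -
    have "U \<noteq> {}" using pair_partition_block[OF that] by auto
    then obtain u where "u \<in> U" by blast
    moreover from this have "u \<in> {1..p}" "block_of \<pi> u = U"
      using block_of_eq[OF that] pair_partition_block[OF that] by auto
    ultimately show ?thesis by (intro bexI[of _ u]) simp_all
  qed
  show ?thesis
  proof (rule bij_betw_byWitness[where f' = ?\<Psi>])
    show "\<forall>a\<in>?A. ?\<Psi> (?\<Phi> a) = a"
    proof
      fix a assume "a \<in> ?A"
      then obtain \<pi> \<kappa> where a: "a = (\<pi>, \<kappa>)" and \<pi>: "\<pi> \<in> pair_partitions p"
        and \<kappa>: "\<kappa> \<in> \<pi> \<rightarrow>\<^sub>E {1..n}" and inj: "inj_on \<kappa> \<pi>" by blast
      let ?k = "?\<Phi> (\<pi>, \<kappa>)"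
      have "?k ` {1..p} = \<kappa> ` \<pi>"
      proof
        show "?k ` {1..p} \<subseteq> \<kappa> ` \<pi>" using block_of_mem[OF \<pi>] by auto
        show "\<kappa> ` \<pi> \<subseteq> ?k ` {1..p}"
        proof
          fix v assume "v \<in> \<kappa> ` \<pi>"
          then obtain U where "U \<in> \<pi>" "v = \<kappa> U" by blast
          moreover from this obtain u where "u \<in> {1..p}" "?k u = \<kappa> U"
            using img[OF \<pi>, of U \<kappa>] by blast
          ultimately show "v \<in> ?k ` {1..p}" by (intro image_eqI[of _ _ u]) simp_all
        qed
      qed
      hence "cls ?k ` ?k ` {1..p} = (\<lambda>U. cls ?k (\<kappa> U)) ` \<pi>" by (simp only: image_image)
      also have "\<dots> = (\<lambda>U. U) ` \<pi>"
        by (rule image_cong[OF refl]) (simp only: cls_def fib[OF \<pi> inj])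
      finally have c: "cls ?k ` ?k ` {1..p} = \<pi>" by simp
      have "(\<lambda>U\<in>\<pi>. the_elem (?k ` U)) = \<kappa>"
      proof
        fix U
        show "(\<lambda>U\<in>\<pi>. the_elem (?k ` U)) U = \<kappa> U"
        proof (cases "U \<in> \<pi>")
          case True
          have "?k ` U = {\<kappa> U}"
          proof
            show "?k ` U \<subseteq> {\<kappa> U}"
              using True block_of_eq[OF \<pi> True] pair_partition_block[OF \<pi> True] by auto
            obtain u where u: "u \<in> U" "?k u = \<kappa> U" using img[OF \<pi> True, of \<kappa>] by blast
            show "{\<kappa> U} \<subseteq> ?k ` U" using imageI[OF u(1), of ?k] unfolding u(2) by blast
          qed
          thus ?thesis using True by simp
        next
          case False
          thus ?thesis using PiE_arb[OF \<kappa> False] by simp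
        qed
      qed
      thus "?\<Psi> (?\<Phi> a) = a" unfolding a Let_def c by simp
    qed
    have inv: "cls k ` k ` {1..p} \<in> pair_partitions p \<and>
        (\<lambda>U\<in>cls k ` k ` {1..p}. the_elem (k ` U)) \<in> cls k ` k ` {1..p} \<rightarrow>\<^sub>E {1..n} \<and>
        inj_on (\<lambda>U\<in>cls k ` k ` {1..p}. the_elem (k ` U)) (cls k ` k ` {1..p}) \<and>
        (\<forall>u\<in>{1..p}. the_elem (k ` cls k (k u)) = k u)" if k: "k \<in> ?B" for k
    proof -
      have the: "the_elem (k ` cls k (k u)) = k u" if "u \<in> {1..p}" for u
      proof -
        have "k ` cls k (k u) = {k u}" using that by (auto simp: cls_def)
        thus ?thesis by simp
      qed
      have "partition_on {1..p} (cls k ` k ` {1..p})"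
        by (rule partition_onI) (auto simp: cls_def disjnt_def)
      hence "cls k ` k ` {1..p} \<in> pair_partitions p"
        using k by (auto simp: pair_partitions_def cls_def)
      moreover have "(\<lambda>U\<in>cls k ` k ` {1..p}. the_elem (k ` U)) \<in> cls k ` k ` {1..p} \<rightarrow>\<^sub>E {1..n}"
        using k the by (intro restrict_PiE_iff[THEN iffD2]) (auto dest: PiE_mem)
      moreover have "inj_on (\<lambda>U\<in>cls k ` k ` {1..p}. the_elem (k ` U)) (cls k ` k ` {1..p})"
      proof (rule inj_onI)
        fix U V assume U: "U \<in> cls k ` k ` {1..p}" and V: "V \<in> cls k ` k ` {1..p}"
          and eq: "(\<lambda>U\<in>cls k ` k ` {1..p}. the_elem (k ` U)) U = (\<lambda>U\<in>cls k ` k ` {1..p}. the_elem (k ` U)) V"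
        obtain u v where u: "u \<in> {1..p}" "U = cls k (k u)" and v: "v \<in> {1..p}" "V = cls k (k v)"
          using U V by blast
        have "the_elem (k ` U) = the_elem (k ` V)" using eq U V by simp
        thus "U = V" using the u v by metis
      qed
      ultimately show ?thesis using the by blast
    qed
    show "\<forall>k\<in>?B. ?\<Phi> (?\<Psi> k) = k"
    proof
      fix k assume k: "k \<in> ?B"
      let ?\<pi> = "cls k ` k ` {1..p}"
      note i = inv[OF k]
      show "?\<Phi> (?\<Psi> k) = k"
      proof
        fix u
        show "?\<Phi> (?\<Psi> k) u = k u"
        proof (cases "u \<in> {1..p}")
          case True
          have "cls k (k u) \<in> ?\<pi>" "u \<in> cls k (k u)" using True by (auto simp: cls_def)
          hence "block_of ?\<pi> u = cls k (k u)" by (rule block_of_eq[OF conjunct1[OF i]])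
          moreover have "the_elem (k ` cls k (k u)) = k u" using i True by blast
          ultimately show ?thesis using True by (simp add: Let_def)
        next
          case False
          have "k \<in> {1..p} \<rightarrow>\<^sub>E {1..n}" using k by blast
          hence "k u = undefined" using False by (rule PiE_arb)
          thus ?thesis using False unfolding Let_def prod.case by (simp only: restrict_apply if_False)
        qed
      qed
    qed
    show "?\<Phi> ` ?A \<subseteq> ?B"
    proof
      fix k assume "k \<in> ?\<Phi> ` ?A"
      then obtain \<pi> \<kappa> where k: "k = ?\<Phi> (\<pi>, \<kappa>)" and \<pi>: "\<pi> \<in> pair_partitions p"
        and \<kappa>: "\<kappa> \<in> \<pi> \<rightarrow>\<^sub>E {1..n}" and inj: "inj_on \<kappa> \<pi>" by blast
      have "?\<Phi> (\<pi>, \<kappa>) \<in> {1..p} \<rightarrow>\<^sub>E {1..n}"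
        using block_of_mem[OF \<pi>] \<kappa> by (auto dest: PiE_mem)
      moreover have "card {u' \<in> {1..p}. ?\<Phi> (\<pi>, \<kappa>) u' = ?\<Phi> (\<pi>, \<kappa>) u} = 2" if u: "u \<in> {1..p}" for u
      proof -
        have "{u' \<in> {1..p}. ?\<Phi> (\<pi>, \<kappa>) u' = ?\<Phi> (\<pi>, \<kappa>) u} = block_of \<pi> u"
          using fib[OF \<pi> inj, of "block_of \<pi> u"] block_of_mem[OF \<pi> u] u by simp
        thus ?thesis using pair_partition_block[OF \<pi>] block_of_mem[OF \<pi> u] by simp
      qed
      ultimately show "k \<in> ?B" unfolding k by blast
    qed
    show "?\<Psi> ` ?B \<subseteq> ?A"
    proof (rule image_subsetI)
      fix k assume "k \<in> ?B"
      thus "?\<Psi> k \<in> ?A" using inv[of k] unfolding Let_def by (intro SigmaI CollectI conjI) blast+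
    qed
  qed
qed

text \<open>Each entry pairs a vertex with the exponent 1. For variables of mean zero the centred
  first power is the variable itself, so the word encodes the plain product over an arbitrary index
  tuple k.\<close>

definition pair_word :: "nat \<Rightarrow> (nat \<Rightarrow> 'l) \<Rightarrow> (nat \<Rightarrow> nat) \<Rightarrow> ((nat \<times> 'l) \<times> nat) list" where
  "pair_word p l k = map (\<lambda>v. (v, 1)) (index_word p l k)"

lemma pair_word_simps:
  "map fst (pair_word p l k) = index_word p l k" "map snd (pair_word p l k) = replicate p 1"
  by (simp_all add: pair_word_def index_word_def comp_def map_replicate_const del: upt_Suc)

lemma set_index_word: "set (index_word p l k) = (\<lambda>u. (k u, l u)) ` {1..p}"
  by (auto simp: index_word_def simp del: upt_Suc)

lemma pair_word_vertices: "k \<in> {1..p} \<rightarrow>\<^sub>E {1..n} \<Longrightarrow> fst ` set (pair_word p l k) \<subseteq> {1..n} \<times> UNIV"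
  by (auto simp: pair_word_def set_index_word image_image dest: PiE_mem)

lemma subseq_index_word:
  assumes "1 \<le> i" "i < k" "k < j" "j < m" "m \<le> p"
  shows "subseq [(\<kappa> i, l i), (\<kappa> k, l k), (\<kappa> j, l j), (\<kappa> m, l m)] (index_word p l \<kappa>)"
proof -
  have "subseq [i, k, j, m] [1..<p + 1]"
    by (rule sorted_subset_imp_subseq) (use assms in \<open>auto simp del: upt_Suc\<close>)
  from subseq_map[OF this, of "\<lambda>u. (\<kappa> u, l u)"] show ?thesis
    by (simp add: index_word_def del: upt_Suc)
qed

lemma subseq_index_wordE:
  assumes "subseq [a, b, c, d] (index_word p l \<kappa>)"
  obtains i k j m where "1 \<le> i" "i < k" "k < j" "j < m" "m \<le> p"
    "a = (\<kappa> i, l i)" "b = (\<kappa> k, l k)" "c = (\<kappa> j, l j)" "d = (\<kappa> m, l m)"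
proof -
  obtain zs where zs: "subseq zs [1..<p + 1]" "[a, b, c, d] = map (\<lambda>u. (\<kappa> u, l u)) zs"
    using subseq_mapE[OF assms[unfolded index_word_def]] by blast
  obtain i k j m where z: "zs = [i, k, j, m]"
    using zs(2) by (auto simp: Cons_eq_map_conv)
  have "sorted_wrt (<) [1..<p + 1]" by (simp del: upt_Suc)
  hence "sorted_wrt (<) zs" using subseq_sorted_wrt[OF zs(1)] by blast
  moreover have "x \<in> {1..p}" if x: "x \<in> set zs" for x
  proof -
    obtain y where "y \<in> set [1..<p + 1]" "x = y" using zs(1) x by (rule list_emb_set)
    thus ?thesis by (simp del: upt_Suc)
  qed
  ultimately show thesis using that[of i k j m] zs(2) unfolding z by auto
qed

text \<open>If l is not constant on some block, the two positions of this block carry vertices that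
  occur nowhere else, and \<open>M_singleton\<close> applies. Otherwise two positions carry the same
  vertex exactly when they share a block: every letter occurs twice, the patterns u, v, u, v are the
  crossings of blocks, and \<open>M_pairs\<close> gives the indicator.\<close>

lemma M_pair_index:
  fixes n :: nat and E :: "((nat \<times> 'l) \<times> (nat \<times> 'l)) set"
  assumes gm: "graph_moments ({1..n} \<times> UNIV) E \<mu> M" and var: "\<mu> 1 = 0" "\<mu> 2 = 1"
    and \<pi>: "\<pi> \<in> pair_partitions p" and \<kappa>: "\<kappa> \<in> \<pi> \<rightarrow>\<^sub>E {1..n}" and inj: "inj_on \<kappa> \<pi>"
  shows "M (pair_word p l (\<lambda>u\<in>{1..p}. \<kappa> (block_of \<pi> u))) = of_bool (le_ker \<pi> l \<and> compatible E \<pi> l \<kappa>)"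
proof -
  interpret graph_moments "{1..n} \<times> UNIV" E \<mu> M by fact
  define k where "k = (\<lambda>u\<in>{1..p}. \<kappa> (block_of \<pi> u))"
  have k: "k u = \<kappa> (block_of \<pi> u)" if "u \<in> {1..p}" for u using that by (simp add: k_def)
  have kPi: "k \<in> {1..p} \<rightarrow>\<^sub>E {1..n}"
    unfolding k_def using block_of_mem[OF \<pi>] \<kappa> by (auto dest: PiE_mem)
  note V = pair_word_vertices[OF kPi, of l]
  note bm = block_of_mem[OF \<pi>] and be = block_of_eq[OF \<pi>] and bl = pair_partition_block[OF \<pi>]
  have k_eq: "k u = k u' \<longleftrightarrow> block_of \<pi> u = block_of \<pi> u'" if "u \<in> {1..p}" "u' \<in> {1..p}" for u u'
    using k that bm inj by (metis inj_onD)
  show ?thesis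
  proof (cases "le_ker \<pi> l")
    case False
    then obtain U u v where U: "U \<in> \<pi>" "u \<in> U" "v \<in> U" "l u \<noteq> l v" unfolding le_ker_def by blast
    have u: "u \<in> {1..p}" using U bl by blast
    have Uuv: "U = {u, v}"
    proof -
      have "u \<noteq> v" using U(4) by auto
      moreover have "finite U" using bl[OF U(1)] finite_subset by blast
      ultimately show ?thesis using U(2,3) bl[OF U(1)] card_subset_eq[of U "{u, v}"] by simp
    qed
    have "{u' \<in> {1..p}. (k u', l u') = (k u, l u)} = {u}"
    proof -
      have "u' = u" if "u' \<in> {1..p}" "k u' = k u" "l u' = l u" for u'
      proof -
        have "u' \<in> U" using that k_eq[OF that(1) u] bm[OF that(1)] be[OF U(1,2)] by auto
        thus ?thesis using Uuv U(4) that(3) by auto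
      qed
      thus ?thesis using u by auto
    qed
    hence "count_list (map fst (pair_word p l k)) (k u, l u) = 1"
      unfolding pair_word_simps count_list_index_word by simp
    hence "M (pair_word p l k) = 0" by (rule M_singleton[OF V])
    thus ?thesis using False unfolding k_def by simp
  next
    case True
    have v_eq: "(k u, l u) = (k u', l u') \<longleftrightarrow> block_of \<pi> u = block_of \<pi> u'"
      if "u \<in> {1..p}" "u' \<in> {1..p}" for u u'
    proof -
      have "l u = l u'" if "block_of \<pi> u = block_of \<pi> u'"
        using True that bm \<open>u \<in> {1..p}\<close> \<open>u' \<in> {1..p}\<close> unfolding le_ker_def by metis
      thus ?thesis using k_eq[OF that] by auto
    qed
    have "count_list (index_word p l k) v = 2" if v: "v \<in> set (index_word p l k)" for v
    proof -
      obtain u where u: "u \<in> {1..p}" "v = (k u, l u)" using v by (auto simp: set_index_word)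
      have "{u' \<in> {1..p}. (k u', l u') = v} = block_of \<pi> u"
        using v_eq[OF _ u(1)] bm bm[OF u(1)] be[of "block_of \<pi> u"] bl[of "block_of \<pi> u"] unfolding u(2) by blast
      thus ?thesis unfolding count_list_index_word using bl bm[OF u(1)] by simp
    qed
    hence "M (pair_word p l k) =
        of_bool (\<forall>u v. u \<noteq> v \<longrightarrow> subseq [u, v, u, v] (index_word p l k) \<longrightarrow> (u, v) \<in> E)"
      unfolding pair_word_def using V var
      by (intro M_pairs) (auto simp: pair_word_def image_image)
    also have "(\<forall>u v. u \<noteq> v \<longrightarrow> subseq [u, v, u, v] (index_word p l k) \<longrightarrow> (u, v) \<in> E) \<longleftrightarrow>
        compatible E \<pi> l \<kappa>"
    proof
      assume good: "\<forall>u v. u \<noteq> v \<longrightarrow> subseq [u, v, u, v] (index_word p l k) \<longrightarrow> (u, v) \<in> E"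
      have main: "((\<kappa> U, the_elem (l ` U)), (\<kappa> V, the_elem (l ` V))) \<in> E"
        if UV: "U \<in> \<pi>" "V \<in> \<pi>" "U \<noteq> V" and ord: "i < a" "a < j" "j < m" "{i, j} \<subseteq> U" "{a, m} \<subseteq> V" for U V i a j m
      proof -
        have r: "i \<in> {1..p}" "a \<in> {1..p}" "j \<in> {1..p}" "m \<in> {1..p}" using ord bl UV by blast+
        have b: "block_of \<pi> i = U" "block_of \<pi> j = U" "block_of \<pi> a = V" "block_of \<pi> m = V"
          using ord be UV by auto
        have e: "(k i, l i) = (\<kappa> U, the_elem (l ` U))" "(k a, l a) = (\<kappa> V, the_elem (l ` V))"
          using k r b le_ker_block[OF True] UV ord by auto
        have "(k j, l j) = (k i, l i)" "(k m, l m) = (k a, l a)" "(k i, l i) \<noteq> (k a, l a)"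
          using v_eq r b UV by blast+
        moreover have "subseq [(k i, l i), (k a, l a), (k j, l j), (k m, l m)] (index_word p l k)"
          using r ord by (intro subseq_index_word) auto
        ultimately have "((k i, l i), (k a, l a)) \<in> E" using good by metis
        thus ?thesis unfolding e .
      qed
      show "compatible E \<pi> l \<kappa>"
        unfolding compatible_def
      proof (intro ballI impI)
        fix U V assume UV: "U \<in> \<pi>" "V \<in> \<pi>" "U \<noteq> V" and "crossing U V"
        then obtain i a j m where o: "i < a" "a < j" "j < m"
          and "{i, j} \<subseteq> U \<and> {a, m} \<subseteq> V \<or> {i, j} \<subseteq> V \<and> {a, m} \<subseteq> U"
          unfolding crossing_def by blast
        thus "((\<kappa> U, the_elem (l ` U)), (\<kappa> V, the_elem (l ` V))) \<in> E"
          using main[OF UV o] main[OF UV(2,1) UV(3)[symmetric] o] sym_E by blast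
      qed
    next
      assume comp: "compatible E \<pi> l \<kappa>"
      show "\<forall>u v. u \<noteq> v \<longrightarrow> subseq [u, v, u, v] (index_word p l k) \<longrightarrow> (u, v) \<in> E"
      proof (intro allI impI)
        fix u v assume uv: "u \<noteq> v" and "subseq [u, v, u, v] (index_word p l k)"
        then obtain i a j m where o: "1 \<le> i" "i < a" "a < j" "j < m" "m \<le> p"
          and e: "u = (k i, l i)" "v = (k a, l a)" "u = (k j, l j)" "v = (k m, l m)"
          by (elim subseq_index_wordE)
        have r: "i \<in> {1..p}" "a \<in> {1..p}" "j \<in> {1..p}" "m \<in> {1..p}" using o by auto
        let ?U = "block_of \<pi> i" and ?V = "block_of \<pi> a"
        have "?U = block_of \<pi> j" "?V = block_of \<pi> m" "?U \<noteq> ?V"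
          using v_eq r e uv by metis+
        moreover from this have "crossing ?U ?V"
          unfolding crossing_def using o bm r by (intro exI[of _ i] exI[of _ a] exI[of _ j] exI[of _ m]) auto
        ultimately have "((\<kappa> ?U, the_elem (l ` ?U)), (\<kappa> ?V, the_elem (l ` ?V))) \<in> E"
          using comp bm r unfolding compatible_def by blast
        thus "(u, v) \<in> E" using e(1,2) k[OF r(1)] k[OF r(2)] bm[OF r(1)] bm[OF r(2)]
            le_ker_block[OF True, of ?U i] le_ker_block[OF True, of ?V a] by simp
      qed
    qed
    finally show ?thesis using True unfolding k_def[symmetric] by simp
  qed
qed

text \<open>If all fibres of k had at least two elements, one of them would have more, and p would
  exceed twice the number of values. So some fibre is a single position, and its vertex occurs once
  whatever l is.\<close>

lemma M_index_eq_0: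
  fixes n :: nat
  assumes gm: "graph_moments ({1..n} \<times> UNIV) E \<mu> M" and k: "k \<in> {1..p} \<rightarrow>\<^sub>E {1..n}"
    and npair: "\<not> (\<forall>u\<in>{1..p}. card {u' \<in> {1..p}. k u' = k u} = 2)"
    and large: "\<not> 2 * card (k ` {1..p}) < p"
  shows "M (pair_word p l k) = 0"
proof -
  interpret graph_moments "{1..n} \<times> UNIV" E \<mu> M by fact
  let ?c = "\<lambda>v. card {u' \<in> {1..p}. k u' = v}"
  have "\<exists>u\<in>{1..p}. ?c (k u) < 2"
  proof (rule ccontr)
    assume "\<not> ?thesis"
    hence ge: "\<forall>v\<in>k ` {1..p}. 2 \<le> ?c v" by (auto simp: not_less)
    moreover obtain u where u: "u \<in> {1..p}" "?c (k u) \<noteq> 2" using npair by blast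
    have "2 \<le> ?c (k u)" using ge imageI[OF u(1)] by (rule bspec)
    hence "2 < ?c (k u)" using u(2) by linarith
    hence "\<exists>v\<in>k ` {1..p}. 2 < ?c v" using imageI[OF u(1)] by (rule bexI)
    ultimately have "(\<Sum>v\<in>k ` {1..p}. 2) < (\<Sum>v\<in>k ` {1..p}. ?c v)"
      by (intro sum_strict_mono_ex1) auto
    also have "(\<Sum>v\<in>k ` {1..p}. ?c v) = (\<Sum>v\<in>k ` {1..p}. \<Sum>u\<in>{u' \<in> {1..p}. k u' = v}. 1)" by simp
    also have "\<dots> = p" by (subst sum.image_gen[symmetric]) auto
    finally show False using large by simp
  qed
  then obtain u where u: "u \<in> {1..p}" "?c (k u) < 2" by blast
  have "u \<in> {u' \<in> {1..p}. (k u', l u') = (k u, l u)}" using u by simp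
  hence "card {u' \<in> {1..p}. (k u', l u') = (k u, l u)} > 0" by (subst card_gt_0_iff) auto
  moreover have "card {u' \<in> {1..p}. (k u', l u') = (k u, l u)} \<le> ?c (k u)" by (rule card_mono) auto
  ultimately have "count_list (map fst (pair_word p l k)) (k u, l u) = 1"
    using u(2) unfolding pair_word_simps count_list_index_word by linarith
  thus ?thesis by (rule M_singleton[OF pair_word_vertices[OF k]])
qed

text \<open>The number \<open>q\<close> is the largest integer below p/2. The two sums differ by
  tuples whose fibres are not all pairs and by non-injective labellings of blocks. In both cases
  every map that contributes takes at most \<open>q\<close> values, so
  \<open>card_PiE_image_le\<close> bounds their number by a multiple of n^q.\<close>

lemma sum_index_estimate:
  fixes n p :: nat and E :: "((nat \<times> 'l) \<times> (nat \<times> 'l)) set"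
  defines "q \<equiv> (p - 1) div 2"
  assumes gm: "graph_moments ({1..n} \<times> UNIV) E \<mu> M" and var: "\<mu> 1 = 0" "\<mu> 2 = 1"
    and n: "n \<ge> 1" and p: "p \<ge> 1"
    and C: "\<And>k. k \<in> {1..p} \<rightarrow>\<^sub>E {1..n} \<Longrightarrow> norm (M (pair_word p l k)) \<le> C"
  shows "norm ((\<Sum>k\<in>{1..p} \<rightarrow>\<^sub>E {1..n}. M (pair_word p l k)) -
      (\<Sum>\<pi> | \<pi> \<in> pair_partitions p \<and> le_ker \<pi> l. \<Sum>\<kappa>\<in>\<pi> \<rightarrow>\<^sub>E {1..n}. of_bool (compatible E \<pi> l \<kappa>)))
    \<le> (\<bar>C\<bar> * real q ^ p + (\<Sum>\<pi> | \<pi> \<in> pair_partitions p \<and> le_ker \<pi> l. real q ^ card \<pi>)) * real n ^ q"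
proof -
  let ?K = "{1..p} \<rightarrow>\<^sub>E {1..n}" and ?P = "{\<pi> \<in> pair_partitions p. le_ker \<pi> l}"
  let ?K2 = "{k \<in> ?K. \<forall>u\<in>{1..p}. card {u' \<in> {1..p}. k u' = k u} = 2}"
  let ?S = "{k \<in> ?K. card (k ` {1..p}) \<le> q}"
  let ?m = "\<lambda>k. M (pair_word p l k)"
  let ?inj = "\<lambda>\<pi>. {\<kappa> \<in> \<pi> \<rightarrow>\<^sub>E {1..n}. inj_on \<kappa> \<pi>}"
  let ?h = "\<lambda>\<pi> \<kappa>. of_bool (compatible E \<pi> l \<kappa>) :: complex"
  have finK: "finite ?K" by (intro finite_PiE) auto
  have finS: "finite ?S" by (rule finite_subset[OF _ finK]) blast
  have finP: "finite ?P" using pair_partitions_finite by simp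
  have fin\<pi>: "finite (\<pi> \<rightarrow>\<^sub>E {1..n})" if "\<pi> \<in> pair_partitions p" for \<pi>
    using pair_partition_finite[OF that] by (intro finite_PiE) auto
  have small: "2 * c < p \<longleftrightarrow> c \<le> q" for c unfolding q_def using p by linarith
  have K2: "(\<Sum>k\<in>?K2. ?m k) = (\<Sum>\<pi>\<in>?P. \<Sum>\<kappa>\<in>?inj \<pi>. ?h \<pi> \<kappa>)"
  proof -
    have "(\<Sum>k\<in>?K2. ?m k) = (\<Sum>(\<pi>, \<kappa>)\<in>(SIGMA \<pi>:pair_partitions p. ?inj \<pi>). ?m (\<lambda>u\<in>{1..p}. \<kappa> (block_of \<pi> u)))"
      using sum.reindex_bij_betw[OF bij_betw_pair_indices[of p n], of ?m] by (simp add: split_beta)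
    also have "\<dots> = (\<Sum>\<pi>\<in>pair_partitions p. \<Sum>\<kappa>\<in>?inj \<pi>. ?m (\<lambda>u\<in>{1..p}. \<kappa> (block_of \<pi> u)))"
      using pair_partitions_finite fin\<pi> by (subst sum.Sigma) auto
    also have "\<dots> = (\<Sum>\<pi>\<in>pair_partitions p. if le_ker \<pi> l then \<Sum>\<kappa>\<in>?inj \<pi>. ?h \<pi> \<kappa> else 0)"
      using M_pair_index[OF gm var] by (intro sum.cong refl) (auto intro!: sum.cong sum.neutral)
    finally show ?thesis using pair_partitions_finite by (simp add: sum.If_cases Int_def)
  qed
  have rest: "norm (\<Sum>k\<in>?K - ?K2. ?m k) \<le> \<bar>C\<bar> * real q ^ p * real n ^ q"
  proof -
    have eq: "(\<Sum>k\<in>?K - ?K2. ?m k) = (\<Sum>k\<in>(?K - ?K2) \<inter> ?S. ?m k)"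
      using finK M_index_eq_0[OF gm, of _ p l] small by (intro sum.mono_neutral_right) auto
    have "norm (\<Sum>k\<in>?K - ?K2. ?m k) \<le> real (card ((?K - ?K2) \<inter> ?S)) * \<bar>C\<bar>"
      unfolding eq
    proof (rule sum_norm_bound)
      fix k assume "k \<in> (?K - ?K2) \<inter> ?S"
      hence "norm (?m k) \<le> C" by (intro C) blast
      thus "norm (?m k) \<le> \<bar>C\<bar>" by linarith
    qed
    also have "\<dots> \<le> real (q ^ p * n ^ q) * \<bar>C\<bar>"
    proof (rule mult_right_mono)
      have "card ((?K - ?K2) \<inter> ?S) \<le> card ?S"
        using finS by (rule card_mono) (rule Int_lower2)
      also have "\<dots> \<le> q ^ p * n ^ q" using card_PiE_image_le[of "{1..p}" n q] n by simp
      finally show "real (card ((?K - ?K2) \<inter> ?S)) \<le> real (q ^ p * n ^ q)" by (rule of_nat_mono)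
    qed simp
    finally show ?thesis by (simp add: mult_ac)
  qed
  \<comment> \<open>A non-injective labelling misses at least one of card \<pi> = p/2 possible
    values, hence takes at most \<open>q\<close> of them.\<close>
  have noninj: "norm ((\<Sum>\<kappa>\<in>?inj \<pi>. ?h \<pi> \<kappa>) - (\<Sum>\<kappa>\<in>\<pi> \<rightarrow>\<^sub>E {1..n}. ?h \<pi> \<kappa>)) \<le> real q ^ card \<pi> * real n ^ q"
    if \<pi>: "\<pi> \<in> pair_partitions p" for \<pi>
  proof -
    let ?N = "(\<pi> \<rightarrow>\<^sub>E {1..n}) - ?inj \<pi>"
    have eq: "(\<Sum>\<kappa>\<in>?inj \<pi>. ?h \<pi> \<kappa>) - (\<Sum>\<kappa>\<in>\<pi> \<rightarrow>\<^sub>E {1..n}. ?h \<pi> \<kappa>) = - (\<Sum>\<kappa>\<in>?N. ?h \<pi> \<kappa>)"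
      using fin\<pi>[OF \<pi>] by (subst sum_diff) auto
    have "norm (- (\<Sum>\<kappa>\<in>?N. ?h \<pi> \<kappa>)) \<le> real (card ?N) * 1"
      unfolding norm_minus_cancel by (intro sum_norm_bound) auto
    also have "\<dots> \<le> real (q ^ card \<pi> * n ^ q)"
    proof -
      have "card ?N \<le> card {\<kappa> \<in> \<pi> \<rightarrow>\<^sub>E {1..n}. card (\<kappa> ` \<pi>) \<le> q}"
      proof (rule card_mono)
        show "?N \<subseteq> {\<kappa> \<in> \<pi> \<rightarrow>\<^sub>E {1..n}. card (\<kappa> ` \<pi>) \<le> q}"
        proof
          fix \<kappa> assume \<kappa>: "\<kappa> \<in> ?N"
          have "card (\<kappa> ` \<pi>) < card \<pi>"
            using \<kappa> pair_partition_finite[OF \<pi>] card_image_le[of \<pi> \<kappa>] eq_card_imp_inj_on[of \<pi> \<kappa>] by force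
          hence "card (\<kappa> ` \<pi>) \<le> q" using small pair_partition_card[OF \<pi>] by simp
          thus "\<kappa> \<in> {\<kappa> \<in> \<pi> \<rightarrow>\<^sub>E {1..n}. card (\<kappa> ` \<pi>) \<le> q}" using \<kappa> by blast
        qed
      qed (use fin\<pi>[OF \<pi>] in simp)
      also have "\<dots> \<le> q ^ card \<pi> * n ^ q"
        using card_PiE_image_le[OF pair_partition_finite[OF \<pi>] n] .
      finally show ?thesis by (simp only: mult_1_right of_nat_le_iff)
    qed
    finally show ?thesis unfolding eq by simp
  qed
  have eq: "(\<Sum>k\<in>?K. ?m k) - (\<Sum>\<pi>\<in>?P. \<Sum>\<kappa>\<in>\<pi> \<rightarrow>\<^sub>E {1..n}. ?h \<pi> \<kappa>) =
      (\<Sum>k\<in>?K - ?K2. ?m k) + (\<Sum>\<pi>\<in>?P. (\<Sum>\<kappa>\<in>?inj \<pi>. ?h \<pi> \<kappa>) - (\<Sum>\<kappa>\<in>\<pi> \<rightarrow>\<^sub>E {1..n}. ?h \<pi> \<kappa>))"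
    using sum.subset_diff[of ?K2 ?K ?m] finK K2 by (simp add: sum_subtractf)
  have "norm ((\<Sum>k\<in>?K - ?K2. ?m k) + (\<Sum>\<pi>\<in>?P. (\<Sum>\<kappa>\<in>?inj \<pi>. ?h \<pi> \<kappa>) - (\<Sum>\<kappa>\<in>\<pi> \<rightarrow>\<^sub>E {1..n}. ?h \<pi> \<kappa>)))
      \<le> \<bar>C\<bar> * real q ^ p * real n ^ q + (\<Sum>\<pi>\<in>?P. real q ^ card \<pi> * real n ^ q)"
    using rest noninj by (intro norm_triangle_le add_mono sum_norm_le) auto
  also have "\<dots> = (\<bar>C\<bar> * real q ^ p + (\<Sum>\<pi>\<in>?P. real q ^ card \<pi>)) * real n ^ q"
    by (simp add: distrib_right sum_distrib_right)
  finally show ?thesis unfolding eq .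
qed

section \<open>Convergence of the moments\<close>

lemma sum_PiE_Suc:
  fixes f :: "(nat \<Rightarrow> nat) \<Rightarrow> 'c::comm_monoid_add"
  shows "(\<Sum>k\<in>{1..Suc p} \<rightarrow>\<^sub>E {1..n}. f k) = (\<Sum>k\<in>{1..p} \<rightarrow>\<^sub>E {1..n}. \<Sum>j\<in>{1..n}. f (k(Suc p := j)))"
proof -
  have "{1..Suc p} \<rightarrow>\<^sub>E {1..n} = (\<lambda>(j, k). k(Suc p := j)) ` ({1..n} \<times> ({1..p} \<rightarrow>\<^sub>E {1..n}))"
    using PiE_insert_eq[of "Suc p" "{1..p}" "\<lambda>_. {1..n}"] by (simp add: atLeastAtMostSuc_conv)
  hence "(\<Sum>k\<in>{1..Suc p} \<rightarrow>\<^sub>E {1..n}. f k) = (\<Sum>(j, k)\<in>{1..n} \<times> ({1..p} \<rightarrow>\<^sub>E {1..n}). f (k(Suc p := j)))"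
    using sum.reindex[OF inj_combinator[of "Suc p" "{1..p}" "\<lambda>_. {1..n}"], of f] by (simp add: split_beta)
  also have "\<dots> = (\<Sum>j\<in>{1..n}. \<Sum>k\<in>{1..p} \<rightarrow>\<^sub>E {1..n}. f (k(Suc p := j)))"
    by (simp add: sum.cartesian_product)
  finally show ?thesis using sum.swap by fastforce
qed

context nc_prob_space
begin

lemma state_mult_finsum:
  assumes "finite I" "p \<in> carrier A" "q \<in> carrier A" "\<And>i. i \<in> I \<Longrightarrow> f i \<in> carrier A"
  shows "state A (p \<otimes> (finsum A f I \<otimes> q)) = (\<Sum>i\<in>I. state A (p \<otimes> (f i \<otimes> q)))"
  using assms(1,4)
proof (induction I)
  case empty
  have "state A \<zero> = 0" using state_smult[of \<zero> 0] by simp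
  thus ?case using assms(2,3) by simp
next
  case (insert i I)
  hence "f \<in> I \<rightarrow> carrier A" by auto
  thus ?case using insert assms(2,3) by (simp add: finsum_insert state_mult_add finsum_closed)
qed

lemma ordered_prod_eq_list_prod: "ordered_prod A p x = list_prod A (map x [1..<p + 1])"
  by (simp add: ordered_prod_def list_prod_def)

lemma ordered_prod_closed: "(\<And>u. u \<in> {1..p} \<Longrightarrow> x u \<in> carrier A) \<Longrightarrow> ordered_prod A p x \<in> carrier A"
  unfolding ordered_prod_eq_list_prod by (rule list_prod_closed) (auto simp del: upt_Suc)

lemma ordered_prod_Suc:
  assumes "\<And>u. u \<in> {1..Suc p} \<Longrightarrow> x u \<in> carrier A"
  shows "ordered_prod A (Suc p) x = ordered_prod A p x \<otimes> x (Suc p)"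
proof -
  have "[1..<Suc p + 1] = [1..<p + 1] @ [Suc p]" by simp
  moreover have "set (map x [1..<p + 1]) \<subseteq> carrier A" using assms by (auto simp del: upt_Suc)
  ultimately show ?thesis
    unfolding ordered_prod_eq_list_prod using assms[of "Suc p"]
    by (simp add: list_prod_append del: upt_Suc)
qed

lemma ordered_prod_cong:
  "(\<And>u. u \<in> {1..p} \<Longrightarrow> x u = y u) \<Longrightarrow> ordered_prod A p x = ordered_prod A p y"
  unfolding ordered_prod_eq_list_prod by (intro arg_cong[where f = "list_prod A"] map_cong) (auto simp del: upt_Suc)

lemma normalized_sum_closed: "(\<And>k. k \<in> {1..n} \<Longrightarrow> y k \<in> carrier A) \<Longrightarrow> normalized_sum A n y \<in> carrier A"
  unfolding normalized_sum_def by (intro scale_closed finsum_closed) auto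

text \<open>The right factor q is there for the induction: the last sum of the product is peeled off
  and absorbed into it. The expansion of a moment is the case where q is the unit.\<close>

lemma state_ordered_prod_normalized_sum:
  assumes y: "\<And>k r. k \<in> {1..n} \<Longrightarrow> y k r \<in> carrier A" and q: "q \<in> carrier A"
  shows "state A (ordered_prod A p (\<lambda>u. normalized_sum A n (\<lambda>k. y k (l u))) \<otimes> q) =
    complex_of_real (1 / sqrt (real n)) ^ p *
      (\<Sum>k\<in>{1..p} \<rightarrow>\<^sub>E {1..n}. state A (ordered_prod A p (\<lambda>u. y (k u) (l u)) \<otimes> q))"
  using q
proof (induction p arbitrary: q)
  case 0
  have "ordered_prod A 0 x = \<one>" for x by (simp add: ordered_prod_def)
  thus ?case using 0 by simp
next
  case (Suc p)
  let ?c = "complex_of_real (1 / sqrt (real n))"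
  let ?S = "\<lambda>u. normalized_sum A n (\<lambda>k. y k (l u))"
  let ?T = "\<lambda>k. ordered_prod A p (\<lambda>u. y (k u) (l u))"
  have S: "?S u \<in> carrier A" for u using y by (intro normalized_sum_closed) auto
  have T: "?T k \<in> carrier A" if "k \<in> {1..p} \<rightarrow>\<^sub>E {1..n}" for k
    using that y by (intro ordered_prod_closed) (auto dest: PiE_mem)
  have step: "state A (?T k \<otimes> (?S (Suc p) \<otimes> q)) =
      ?c * (\<Sum>j\<in>{1..n}. state A (ordered_prod A (Suc p) (\<lambda>u. y ((k(Suc p := j)) u) (l u)) \<otimes> q))"
    if k: "k \<in> {1..p} \<rightarrow>\<^sub>E {1..n}" for k
  proof -
    have fin: "finsum A (\<lambda>k. y k (l (Suc p))) {1..n} \<in> carrier A" using y by (intro finsum_closed) auto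
    have "state A (?T k \<otimes> (?S (Suc p) \<otimes> q)) = ?c * state A (?T k \<otimes> (finsum A (\<lambda>k. y k (l (Suc p))) {1..n} \<otimes> q))"
      unfolding normalized_sum_def using T[OF k] Suc.prems fin by (rule state_mult_smult)
    also have "\<dots> = ?c * (\<Sum>j\<in>{1..n}. state A (?T k \<otimes> (y j (l (Suc p)) \<otimes> q)))"
      using T[OF k] Suc.prems y by (subst state_mult_finsum) auto
    also have "(\<Sum>j\<in>{1..n}. state A (?T k \<otimes> (y j (l (Suc p)) \<otimes> q))) =
        (\<Sum>j\<in>{1..n}. state A (ordered_prod A (Suc p) (\<lambda>u. y ((k(Suc p := j)) u) (l u)) \<otimes> q))"
    proof (rule sum.cong[OF refl])
      fix j assume j: "j \<in> {1..n}"
      have "ordered_prod A (Suc p) (\<lambda>u. y ((k(Suc p := j)) u) (l u)) =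
          ordered_prod A p (\<lambda>u. y ((k(Suc p := j)) u) (l u)) \<otimes> y j (l (Suc p))"
      proof (subst ordered_prod_Suc)
        fix u assume u: "u \<in> {1..Suc p}"
        have "(k(Suc p := j)) u \<in> {1..n}"
          using j PiE_mem[OF k, of u] u by (cases "u = Suc p") auto
        thus "y ((k(Suc p := j)) u) (l u) \<in> carrier A" by (rule y)
      qed simp
      also have "ordered_prod A p (\<lambda>u. y ((k(Suc p := j)) u) (l u)) = ?T k"
        by (rule ordered_prod_cong) auto
      finally show "state A (?T k \<otimes> (y j (l (Suc p)) \<otimes> q)) =
          state A (ordered_prod A (Suc p) (\<lambda>u. y ((k(Suc p := j)) u) (l u)) \<otimes> q)"
        using T[OF k] y[OF j] Suc.prems by (simp add: m_assoc)
    qed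
    finally show ?thesis .
  qed
  have "ordered_prod A (Suc p) ?S \<otimes> q = ordered_prod A p ?S \<otimes> (?S (Suc p) \<otimes> q)"
    using S Suc.prems by (simp add: ordered_prod_Suc ordered_prod_closed m_assoc)
  also have "state A \<dots> = ?c ^ p * (\<Sum>k\<in>{1..p} \<rightarrow>\<^sub>E {1..n}. state A (?T k \<otimes> (?S (Suc p) \<otimes> q)))"
    using S Suc.prems by (intro Suc.IH) auto
  also have "\<dots> = ?c ^ Suc p * (\<Sum>k\<in>{1..p} \<rightarrow>\<^sub>E {1..n}.
      \<Sum>j\<in>{1..n}. state A (ordered_prod A (Suc p) (\<lambda>u. y ((k(Suc p := j)) u) (l u)) \<otimes> q))"
    using step by (simp add: sum_distrib_left mult.assoc mult.left_commute)
  finally show ?case unfolding sum_PiE_Suc .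
qed

end

section \<open>Densities of crossing graphs and the limit of the moments\<close>

lemma orientation_subset:
  assumes "orientation f D"
  shows "D \<subseteq> parcs f"
  using assms by (auto simp: orientation_def)

lemma pair_graph_intersection_graph:
  assumes "finite \<pi>"
  shows "pair_graph (intersection_graph \<pi>)"
proof
  have "parcs (intersection_graph \<pi>) \<subseteq> \<pi> \<times> \<pi>" by (auto simp: intersection_graph_def)
  thus "finite (parcs (intersection_graph \<pi>))" using assms by (meson finite_SigmaI finite_subset)
  show "finite (pverts (intersection_graph \<pi>))" using assms by (simp add: intersection_graph_def)
  have "crossing U V \<Longrightarrow> crossing V U" for U V unfolding crossing_def by blast
  thus "symmetric (intersection_graph \<pi>)"
    by (auto simp: symmetric_def sym_def intersection_graph_def)
qed (auto simp: intersection_graph_def)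

lemma decorated_partition_graph:
  assumes "finite \<pi>" "orientation (intersection_graph \<pi>) D"
  shows "decorated_graph (partition_graph D \<pi> l)"
  using assms pair_graph_intersection_graph
  by (auto simp: decorated_graph_def partition_graph_def unit_matrices_def matrix_unit_def axis_def)

text \<open>Convergence is tested on graphs whose vertices are natural numbers, whereas the vertices
  of an intersection graph are sets of numbers. An injection of the finite vertex set into the
  naturals transports graph, orientation and decoration without changing the density.\<close>

lemma graphon_converges_hom_density:
  fixes F :: "('v, 'l::finite) dec_graph"
  assumes conv: "graphon_converges wn w" and F: "decorated_graph F"
  shows "(\<lambda>n. hom_density F (wn n)) \<longlonglongrightarrow> hom_density F w"
proof -
  let ?g = "underlying F"
  interpret pair_graph ?g using F by (simp add: decorated_graph_def)
  obtain f :: "'v \<Rightarrow> nat" where f: "inj_on f (pverts ?g)"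
    using finite_imp_inj_to_nat_seg[OF pair_finite_verts] by blast
  define f' where "f' = inv_into (pverts ?g) f"
  have f': "f' (f v) = v" if "v \<in> pverts ?g" for v using f that by (simp add: f'_def)
  have arcs: "u \<in> pverts ?g" "v \<in> pverts ?g" "(v, u) \<in> parcs ?g" "u \<noteq> v" if "(u, v) \<in> parcs ?g" for u v
    using that in_arcsD1 in_arcsD2 arcs_symmetric pair_no_loops[OF that] by auto
  have D: "oriented_edges F \<subseteq> parcs ?g" "oriented_edges F \<inter> (oriented_edges F)\<inverse> = {}"
    "parcs ?g = oriented_edges F \<union> (oriented_edges F)\<inverse>"
    using F by (auto simp: decorated_graph_def orientation_def)
  define G :: "(nat, 'l) dec_graph" where
    "G = \<lparr>underlying = \<lparr>pverts = f ` pverts ?g, parcs = map_prod f f ` parcs ?g\<rparr>,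
      oriented_edges = map_prod f f ` oriented_edges F,
      decoration = (\<lambda>(a, b). decoration F (f' a, f' b))\<rparr>"
  have "pair_graph (underlying G)"
  proof
    show "finite (pverts (underlying G))" "finite (parcs (underlying G))"
      using pair_finite_verts pair_finite_arcs by (auto simp: G_def)
    show "symmetric (underlying G)"
    proof -
      have "sym (map_prod f f ` parcs ?g)" using arcs(3) by (auto intro!: symI)
      thus ?thesis by (simp add: symmetric_def G_def)
    qed
    fix e assume "e \<in> parcs (underlying G)"
    then obtain u v where e: "e = (f u, f v)" "(u, v) \<in> parcs ?g" by (auto simp: G_def)
    show "fst e \<in> pverts (underlying G)" "snd e \<in> pverts (underlying G)" "fst e \<noteq> snd e"
      using e arcs[OF e(2)] inj_onD[OF f] by (auto simp: G_def)
  qed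
  moreover have "orientation (underlying G) (oriented_edges G)"
  proof -
    have "map_prod f f ` oriented_edges F \<inter> (map_prod f f ` oriented_edges F)\<inverse> = {}"
    proof (rule ccontr)
      assume "\<not> ?thesis"
      then obtain u v u' v' where e: "(u, v) \<in> oriented_edges F" "(u', v') \<in> oriented_edges F"
        "f u = f v'" "f v = f u'" by auto
      have "u = v'" "v = u'" using e arcs(1,2) D(1) inj_onD[OF f] by blast+
      thus False using e(1,2) D(2) by auto
    qed
    moreover have "map_prod f f ` oriented_edges F \<union> (map_prod f f ` oriented_edges F)\<inverse> = map_prod f f ` parcs ?g"
      unfolding D(3) by (auto simp: image_Un)
    ultimately show ?thesis by (simp add: orientation_def G_def)
  qed
  moreover have dec: "decoration G (f u, f v) = decoration F (u, v)" if "(u, v) \<in> oriented_edges F" for u v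
    using that D(1) arcs f' by (auto simp: G_def)
  moreover have "\<forall>e\<in>oriented_edges G. decoration G e \<in> unit_matrices"
  proof
    fix e assume "e \<in> oriented_edges G"
    then obtain u v where e: "e = (f u, f v)" "(u, v) \<in> oriented_edges F" by (auto simp: G_def)
    thus "decoration G e \<in> unit_matrices" using F dec[OF e(2)] by (simp add: decorated_graph_def)
  qed
  ultimately have "decorated_graph G" by (simp add: decorated_graph_def)
  hence "(\<lambda>n. hom_density G (wn n)) \<longlonglongrightarrow> hom_density G w"
    using conv by (simp add: graphon_converges_def)
  moreover have "hom_density G w' = hom_density F w'" for w'
    using f dec D(1) arcs(1,2) by (intro hom_density_relabel[of f]) (auto simp: G_def)
  ultimately show ?thesis by simp
qed

lemma inner_matrix_unit: "matrix_unit i j \<bullet> S = S $ i $ j"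
  by (simp add: matrix_unit_def inner_axis')

text \<open>Pairing with a matrix unit selects one entry of the block decoration, so each edge
  contributes the indicator of an arc of g, and the product over all edges is the indicator of a
  homomorphism. The orientation disappears because the arcs of g are symmetric.\<close>

lemma hom_density_partition_graph:
  fixes g :: "(nat \<times> 'l::finite) pair_pre_digraph"
  assumes n: "n \<ge> 1" and g: "pair_graph g" "pverts g = {1..n} \<times> UNIV"
    and \<pi>: "finite \<pi>" and D: "orientation (intersection_graph \<pi>) D"
  shows "hom_density (partition_graph D \<pi> l) (block_graphon n g) =
    (\<Sum>\<kappa>\<in>\<pi> \<rightarrow>\<^sub>E {1..n}. of_bool (compatible (parcs g) \<pi> l \<kappa>)) / real n ^ card \<pi>"
proof -
  interpret pair_graph g by fact
  let ?F = "partition_graph D \<pi> l"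
  have F: "pverts (underlying ?F) = \<pi>" "oriented_edges ?F = D"
    by (simp_all add: partition_graph_def intersection_graph_def)
  have parcs: "parcs g \<subseteq> ({1..n} \<times> UNIV) \<times> ({1..n} \<times> UNIV)"
    using arc_fst_in_verts arc_snd_in_verts g(2) by fastforce
  have D\<pi>: "D \<subseteq> \<pi> \<times> \<pi>"
    using orientation_subset[OF D] by (auto simp: intersection_graph_def)
  have finD: "finite D" using D\<pi> \<pi> by (meson finite_SigmaI finite_subset)
  have "(\<Prod>(U, V)\<in>D. decoration ?F (U, V) \<bullet> block_decoration g (\<kappa> U) (\<kappa> V)) = of_bool (compatible (parcs g) \<pi> l \<kappa>)"
    for \<kappa>
  proof -
    let ?e = "\<lambda>U V. ((\<kappa> U, the_elem (l ` U)), (\<kappa> V, the_elem (l ` V))) \<in> parcs g"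
    have "(\<Prod>(U, V)\<in>D. decoration ?F (U, V) \<bullet> block_decoration g (\<kappa> U) (\<kappa> V)) = (\<Prod>(U, V)\<in>D. of_bool (?e U V))"
      by (intro prod.cong) (auto simp: partition_graph_def inner_matrix_unit block_decoration_def)
    also have "\<dots> = of_bool (\<forall>(U, V)\<in>D. ?e U V)"
      using finD by (induction D) auto
    also have "(\<forall>(U, V)\<in>D. ?e U V) \<longleftrightarrow> (\<forall>(U, V)\<in>D \<union> D\<inverse>. ?e U V)"
      unfolding ball_Un using arcs_symmetric by auto
    also have "D \<union> D\<inverse> = parcs (intersection_graph \<pi>)" using D by (simp add: orientation_def)
    also have "(\<forall>(U, V)\<in>parcs (intersection_graph \<pi>). ?e U V) \<longleftrightarrow> compatible (parcs g) \<pi> l \<kappa>"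
      unfolding compatible_def intersection_graph_def by auto
    finally show ?thesis .
  qed
  thus ?thesis
    using hom_density_block_graphon[of n g ?F] n parcs \<pi> D\<pi> unfolding F by simp
qed

theorem moments_tendsto:
  fixes A :: "'a nc_space"
    and g :: "nat \<Rightarrow> (nat \<times> 'l::finite) pair_pre_digraph"
    and x :: "nat \<Rightarrow> nat \<Rightarrow> 'l \<Rightarrow> 'a"
  assumes A: "nc_prob_space A"
    and g: "\<And>n. n \<ge> 1 \<Longrightarrow> pair_graph (g n) \<and> pverts (g n) = {1..n} \<times> UNIV"
    and conv: "graphon_converges (\<lambda>n. block_graphon n (g n)) w"
    and a: "a \<in> carrier A" "state A a = 0" "state A (a [^]\<^bsub>A\<^esub> (2::nat)) = 1"
    and x: "\<And>n k r. n \<ge> 1 \<Longrightarrow> k \<in> {1..n} \<Longrightarrow> x n k r \<in> carrier A \<and> same_law A (x n k r) a"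
    and ind: "\<And>n. n \<ge> 1 \<Longrightarrow> g_independent A (g n) (\<lambda>(k, r). x n k r)"
    and p: "p \<ge> 1"
    and D: "\<forall>\<pi>\<in>pair_partitions p. orientation (intersection_graph \<pi>) (D \<pi>)"
  shows "(\<lambda>n. state A (ordered_prod A p (\<lambda>u. normalized_sum A n (\<lambda>k. x n k (l u)))))
    \<longlonglongrightarrow> complex_of_real (limit_moment D w p l)"
proof -
  interpret nc_prob_space A by fact
  define \<mu> where "\<mu> = (\<lambda>m::nat. state A (a [^]\<^bsub>A\<^esub> m))"
  have var: "\<mu> 1 = 0" "\<mu> 2 = 1" using a by (simp_all add: \<mu>_def)
  define M where "M = (\<lambda>n ws. state A (list_prod A (map (\<lambda>(v, m). centered_pow A ((\<lambda>(k, r). x n k r) v) m) ws)))"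
  have gm: "graph_moments ({1..n} \<times> UNIV) (parcs (g n)) \<mu> (M n)" if n: "n \<ge> 1" for n
    unfolding M_def using graph_moments[of "g n" "\<lambda>(k, r). x n k r" \<mu>] g[OF n] ind[OF n] x[OF n]
    by (auto simp: same_law_def \<mu>_def)
  \<comment> \<open>C is fixed before n, so one bound serves all the graphs
    \<open>g n\<close>.\<close>
  obtain C where C: "\<And>V (E :: ((nat \<times> 'l) \<times> (nat \<times> 'l)) set) M ws. graph_moments V E \<mu> M \<Longrightarrow>
      fst ` set ws \<subseteq> V \<Longrightarrow> map snd ws = replicate p 1 \<Longrightarrow> norm (M ws) \<le> C"
    using graph_moments_bound[where \<mu> = \<mu> and ms = "replicate p 1"] by blast
  define q where "q = (p - 1) div 2"
  let ?P = "{\<pi> \<in> pair_partitions p. le_ker \<pi> l}"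
  define K where "K = \<bar>C\<bar> * real q ^ p + (\<Sum>\<pi>\<in>?P. real q ^ card \<pi>)"
  define lm where "lm = (\<lambda>n. \<Sum>\<pi>\<in>?P. hom_density (partition_graph (D \<pi>) \<pi> l) (block_graphon n (g n)))"
  let ?s = "\<lambda>n. state A (ordered_prod A p (\<lambda>u. normalized_sum A n (\<lambda>k. x n k (l u))))"
  have est: "norm (?s n - complex_of_real (lm n)) \<le> K / sqrt (real n)" if n: "n \<ge> 1" for n
  proof -
    let ?c = "1 / sqrt (real n)"
    let ?X = "\<Sum>k\<in>{1..p} \<rightarrow>\<^sub>E {1..n}. M n (pair_word p l k)"
    let ?Y = "\<Sum>\<pi>\<in>?P. \<Sum>\<kappa>\<in>\<pi> \<rightarrow>\<^sub>E {1..n}. of_bool (compatible (parcs (g n)) \<pi> l \<kappa>) :: complex"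
    have xc: "x n k r \<in> carrier A" if "k \<in> {1..n}" for k r using x[OF n that] by blast
    have M_word: "M n (pair_word p l k) = state A (ordered_prod A p (\<lambda>u. x n (k u) (l u)))"
      if k: "k \<in> {1..p} \<rightarrow>\<^sub>E {1..n}" for k
    proof -
      have "centered_pow A (x n i r) 1 = x n i r" if i: "i \<in> {1..n}" for i r
      proof -
        have "state A (x n i r [^]\<^bsub>A\<^esub> (1::nat)) = \<mu> 1"
          using x[OF n i, of r] unfolding same_law_def \<mu>_def by blast
        hence "state A (x n i r [^]\<^bsub>A\<^esub> (1::nat)) = 0" using var(1) by simp
        thus ?thesis using xc[OF i] smult_l_null[of "\<one>\<^bsub>A\<^esub>"] by (simp add: centered_pow_def)
      qed
      hence "centered_pow A (x n (k u) (l u)) 1 = x n (k u) (l u)" if "u \<in> {1..p}" for u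
        using PiE_mem[OF k that] by blast
      hence "map (\<lambda>(v, m). centered_pow A ((\<lambda>(k, r). x n k r) v) m) (pair_word p l k) =
          map (\<lambda>u. x n (k u) (l u)) [1..<p + 1]"
        by (auto simp: pair_word_def index_word_def simp del: upt_Suc)
      thus ?thesis unfolding M_def ordered_prod_eq_list_prod by simp
    qed
    have sn: "?s n = complex_of_real ?c ^ p * ?X"
    proof -
      have cl: "ordered_prod A p (\<lambda>u. x n (k u) (l u)) \<in> carrier A" if "k \<in> {1..p} \<rightarrow>\<^sub>E {1..n}" for k
        using that xc by (intro ordered_prod_closed) (auto dest: PiE_mem)
      have "ordered_prod A p (\<lambda>u. normalized_sum A n (\<lambda>k. x n k (l u))) \<in> carrier A"
        using xc by (intro ordered_prod_closed normalized_sum_closed)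
      thus ?thesis
        using state_ordered_prod_normalized_sum[of n "x n" "\<one>\<^bsub>A\<^esub>" p l] xc cl M_word by simp
    qed
    have lmn: "complex_of_real (lm n) = complex_of_real ?c ^ p * ?Y"
    proof -
      have "complex_of_real (hom_density (partition_graph (D \<pi>) \<pi> l) (block_graphon n (g n))) =
          complex_of_real ?c ^ p * (\<Sum>\<kappa>\<in>\<pi> \<rightarrow>\<^sub>E {1..n}. of_bool (compatible (parcs (g n)) \<pi> l \<kappa>))"
        if \<pi>: "\<pi> \<in> pair_partitions p" for \<pi>
      proof -
        \<comment> \<open>As p = 2 * card \<pi>, the normalization n^(-p/2) of the moment is the
          factor n^(-card \<pi>) of the density.\<close>
        have "?c ^ p = (?c ^ 2) ^ card \<pi>" using pair_partition_card[OF \<pi>] by (metis power_mult)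
        also have "\<dots> = 1 / real n ^ card \<pi>" by (simp add: power_divide)
        finally have c: "complex_of_real ?c ^ p = complex_of_real (1 / real n ^ card \<pi>)" by (metis of_real_power)
        show ?thesis
          unfolding c using hom_density_partition_graph[of n "g n" \<pi> "D \<pi>" l] n g[OF n] pair_partition_finite[OF \<pi>] D \<pi>
          by (simp add: of_bool_def if_distrib[of complex_of_real] cong: if_cong)
      qed
      thus ?thesis unfolding lm_def of_real_sum by (simp add: sum_distrib_left)
    qed
    have "norm (?X - ?Y) \<le> K * real n ^ q"
      unfolding K_def q_def
    proof (rule sum_index_estimate[OF gm[OF n] var n p])
      fix k assume k: "k \<in> {1..p} \<rightarrow>\<^sub>E {1..n}"
      show "norm (M n (pair_word p l k)) \<le> C"
        using C[OF gm[OF n] pair_word_vertices[OF k]] pair_word_simps(2) by blast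
    qed
    moreover have "norm (complex_of_real ?c) = ?c" unfolding norm_of_real by simp
    ultimately have "norm (?s n - complex_of_real (lm n)) \<le> ?c ^ p * (K * real n ^ q)"
      unfolding sn lmn right_diff_distrib[symmetric] norm_mult norm_power
      by (simp only: mult_left_mono zero_le_power zero_le_divide_1_iff real_sqrt_ge_0_iff of_nat_0_le_iff)
    also have "\<dots> = K * (?c ^ p * real n ^ q)" by simp
    \<comment> \<open>Since p is at least 2q + 1, the product n^(-p/2) * n^q is at most
      n^(-1/2).\<close>
    also have "\<dots> \<le> K * ?c"
    proof (rule mult_left_mono)
      have "?c ^ p \<le> ?c ^ (2 * q + 1)"
        using n p by (intro power_decreasing) (auto simp: q_def)
      also have "\<dots> = ?c / real n ^ q" by (simp add: power_mult power_divide)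
      finally show "?c ^ p * real n ^ q \<le> ?c" using n by (simp add: field_simps)
      show "0 \<le> K" unfolding K_def by (intro add_nonneg_nonneg sum_nonneg) auto
    qed
    finally show ?thesis by simp
  qed
  have "filterlim (\<lambda>n. sqrt (real n)) at_top sequentially"
    by (rule filterlim_compose[OF sqrt_at_top filterlim_real_sequentially])
  hence "(\<lambda>n. K / sqrt (real n)) \<longlonglongrightarrow> 0"
    by (intro tendsto_divide_0[OF tendsto_const] filterlim_at_top_imp_at_infinity)
  hence diff: "(\<lambda>n. ?s n - complex_of_real (lm n)) \<longlonglongrightarrow> 0"
  proof (rule Lim_null_comparison[rotated])
    show "\<forall>\<^sub>F n in sequentially. norm (?s n - complex_of_real (lm n)) \<le> K / sqrt (real n)"
      by (rule eventually_sequentiallyI[of 1]) (rule est)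
  qed
  have "lm \<longlonglongrightarrow> limit_moment D w p l"
    unfolding lm_def limit_moment_def
    using D pair_partition_finite
    by (intro tendsto_sum graphon_converges_hom_density[OF conv] decorated_partition_graph) auto
  hence "(\<lambda>n. complex_of_real (lm n)) \<longlonglongrightarrow> complex_of_real (limit_moment D w p l)" by (rule tendsto_of_real)
  from tendsto_add[OF diff this] show ?thesis by simp
qed

section \<open>Realization of positive tracial functionals on words\<close>

text \<open>For f of finite support, regarded as a combination of words, this is the value at f of
  the linear functional that equals h on words. No conjugation is involved: it is linear in both
  arguments.\<close>

definition pairing :: "('w \<Rightarrow> complex) \<Rightarrow> ('w \<Rightarrow> complex) \<Rightarrow> complex" where
  "pairing f h = (\<Sum>w | f w \<noteq> 0. f w * h w)"

lemma pairing_superset: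
  "finite W \<Longrightarrow> {w. f w \<noteq> 0} \<subseteq> W \<Longrightarrow> pairing f h = (\<Sum>w\<in>W. f w * h w)"
  unfolding pairing_def by (rule sum.mono_neutral_left) auto

lemma pairing_add_left:
  assumes "finite {w. f w \<noteq> 0}" "finite {w. g w \<noteq> 0}"
  shows "pairing (\<lambda>w. f w + g w) h = pairing f h + pairing g h"
proof -
  let ?W = "{w. f w \<noteq> 0} \<union> {w. g w \<noteq> 0}"
  have W: "finite ?W" using assms by simp
  have "pairing (\<lambda>w. f w + g w) h = (\<Sum>w\<in>?W. (f w + g w) * h w)"
    by (rule pairing_superset[OF W]) auto
  also have "\<dots> = (\<Sum>w\<in>?W. f w * h w) + (\<Sum>w\<in>?W. g w * h w)"
    by (simp add: distrib_right sum.distrib)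
  also have "\<dots> = pairing f h + pairing g h"
    using pairing_superset[OF W, of f h] pairing_superset[OF W, of g h] by auto
  finally show ?thesis .
qed

lemma pairing_scale_left: "pairing (\<lambda>w. c * f w) h = c * pairing f h"
  by (cases "c = 0") (simp_all add: pairing_def sum_distrib_left mult.assoc)

lemma pairing_zero_left: "pairing (\<lambda>w. 0) h = 0"
  by (simp add: pairing_def)

lemma pairing_add_right: "pairing f (\<lambda>w. h w + k w) = pairing f h + pairing f k"
  by (simp add: pairing_def distrib_left sum.distrib)

lemma pairing_scale_right: "pairing f (\<lambda>w. c * h w) = c * pairing f h"
  by (simp add: pairing_def sum_distrib_left mult.left_commute)

lemma pairing_swap: "pairing f (\<lambda>a. pairing g (\<lambda>b. h a b)) = pairing g (\<lambda>b. pairing f (\<lambda>a. h a b))"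
  unfolding pairing_def sum_distrib_left by (subst sum.swap) (simp add: mult.left_commute)

section \<open>The free algebra on the letters\<close>

definition unit_word :: "'l list \<Rightarrow> 'l list \<Rightarrow> complex" where
  "unit_word u = (\<lambda>w. of_bool (w = u))"

lemma finite_unit_word [simp]: "finite {w. unit_word u w \<noteq> 0}"
  by (simp add: unit_word_def)

lemma pairing_unit_word [simp]: "pairing (unit_word u) h = h u"
  by (simp add: pairing_def unit_word_def)

text \<open>The product of the free algebra, which extends concatenation of words
  bilinearly.\<close>

definition convolution :: "('l list \<Rightarrow> complex) \<Rightarrow> ('l list \<Rightarrow> complex) \<Rightarrow> 'l list \<Rightarrow> complex" where
  "convolution f g w = (\<Sum>(u, v) | u @ v = w. f u * g v)"

lemma finite_splits: "finite {(u, v). u @ v = w}"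
proof (rule finite_subset)
  show "{(u, v). u @ v = w} \<subseteq> (\<lambda>i. (take i w, drop i w)) ` {..length w}"
  proof clarify
    fix u v assume "w = u @ v"
    thus "(u, v) \<in> (\<lambda>i. (take i (u @ v), drop i (u @ v))) ` {..length (u @ v)}"
      by (intro image_eqI[of _ _ "length u"]) auto
  qed
qed simp

lemma convolution_support:
  "{w. convolution f g w \<noteq> 0} \<subseteq> (\<lambda>(u, v). u @ v) ` ({u. f u \<noteq> 0} \<times> {v. g v \<noteq> 0})"
proof
  fix w assume w: "w \<in> {w. convolution f g w \<noteq> 0}"
  have "\<exists>u v. u @ v = w \<and> f u * g v \<noteq> 0"
  proof (rule ccontr)
    assume "\<not> ?thesis"
    hence "convolution f g w = 0" unfolding convolution_def by (intro sum.neutral) auto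
    thus False using w by simp
  qed
  thus "w \<in> (\<lambda>(u, v). u @ v) ` ({u. f u \<noteq> 0} \<times> {v. g v \<noteq> 0})" by force
qed

lemma finite_convolution [simp]:
  assumes "finite {w. f w \<noteq> 0}" "finite {w. g w \<noteq> 0}"
  shows "finite {w. convolution f g w \<noteq> 0}"
  using convolution_support by (rule finite_subset) (use assms in simp)

lemma pairing_convolution:
  assumes f: "finite {w. f w \<noteq> 0}" and g: "finite {w. g w \<noteq> 0}"
  shows "pairing (convolution f g) h = pairing f (\<lambda>u. pairing g (\<lambda>v. h (u @ v)))"
proof -
  let ?Z = "{u. f u \<noteq> 0} \<times> {v. g v \<noteq> 0}" and ?app = "\<lambda>(u, v). u @ v"
  have "pairing (convolution f g) h = (\<Sum>w\<in>?app ` ?Z. convolution f g w * h w)"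
    using f g convolution_support by (intro pairing_superset) auto
  also have "\<dots> = (\<Sum>w\<in>?app ` ?Z. \<Sum>x\<in>{x \<in> ?Z. ?app x = w}. f (fst x) * g (snd x) * h (?app x))"
  proof (rule sum.cong[OF refl])
    fix w
    have "convolution f g w = (\<Sum>x\<in>{(u, v). u @ v = w}. f (fst x) * g (snd x))"
      unfolding convolution_def by (simp add: split_beta)
    also have "\<dots> = (\<Sum>x\<in>{x \<in> ?Z. ?app x = w}. f (fst x) * g (snd x))"
      by (rule sum.mono_neutral_right[OF finite_splits]) auto
    finally show "convolution f g w * h w =
        (\<Sum>x\<in>{x \<in> ?Z. ?app x = w}. f (fst x) * g (snd x) * h (?app x))"
      by (simp add: sum_distrib_right)
  qed
  also have "\<dots> = (\<Sum>x\<in>?Z. f (fst x) * g (snd x) * h (?app x))"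
    using f g by (intro sum.image_gen[symmetric]) simp
  also have "\<dots> = (\<Sum>u | f u \<noteq> 0. \<Sum>v | g v \<noteq> 0. f u * g v * h (u @ v))"
    by (simp add: sum.cartesian_product split_beta)
  finally show ?thesis by (simp add: pairing_def sum_distrib_left mult.assoc)
qed

text \<open>The involution of the free algebra that fixes every letter, so that the letters become
  self-adjoint variables.\<close>

definition star :: "('l list \<Rightarrow> complex) \<Rightarrow> 'l list \<Rightarrow> complex" where
  "star f w = cnj (f (rev w))"

lemma star_support: "{w. star f w \<noteq> 0} = rev ` {w. f w \<noteq> 0}"
  by (auto simp: star_def intro: image_eqI[of _ rev "rev _"])

lemma finite_star [simp]: "finite {w. f w \<noteq> 0} \<Longrightarrow> finite {w. star f w \<noteq> 0}"
  unfolding star_support by simp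

lemma pairing_star: "pairing (star f) h = cnj (pairing f (\<lambda>w. cnj (h (rev w))))"
proof -
  have "inj_on rev {w. f w \<noteq> 0}" by (rule inj_onI) simp
  thus ?thesis
    unfolding pairing_def star_support by (simp add: sum.reindex star_def)
qed

text \<open>The properties of \<open>\<nu> (l\<^sub>1 \<dots> l\<^sub>p) = \<tau> (s\<^sub>l\<^sub>1 \<dots> s\<^sub>l\<^sub>p)\<close> for self-adjoint \<open>s\<^sub>l\<close> that allow
  the space and the \<open>s\<^sub>l\<close> to be recovered from \<open>\<nu>\<close>.\<close>

locale word_state =
  fixes \<nu> :: "'l list \<Rightarrow> complex"
  assumes \<nu>_Nil: "\<nu> [] = 1"
    and \<nu>_tracial: "\<nu> (u @ v) = \<nu> (v @ u)"
    and \<nu>_rev: "\<nu> (rev w) = cnj (\<nu> w)"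
    and \<nu>_pos: "finite {w. f w \<noteq> 0} \<Longrightarrow>
      (\<Sum>u | f u \<noteq> 0. \<Sum>v | f v \<noteq> 0. cnj (f u) * f v * \<nu> (rev u @ v)) \<in> \<real>\<^sub>\<ge>\<^sub>0"
begin

text \<open>By the trace property, \<open>functional f = 0\<close> says that \<open>f\<close> is orthogonal to the free algebra
  on both sides, so the kernel of \<open>functional\<close> is the ideal to divide by.\<close>

definition functional :: "('l list \<Rightarrow> complex) \<Rightarrow> 'l list \<Rightarrow> complex" where
  "functional f = (\<lambda>u. pairing f (\<lambda>v. \<nu> (u @ v)))"

text \<open>Equality of functionals expresses that the difference lies in the kernel; finite support
  keeps the class inside the free algebra.\<close>

definition cls :: "('l list \<Rightarrow> complex) \<Rightarrow> ('l list \<Rightarrow> complex) set" where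
  "cls f = {h. finite {w. h w \<noteq> 0} \<and> functional h = functional f}"

definition rep :: "('l list \<Rightarrow> complex) set \<Rightarrow> 'l list \<Rightarrow> complex" where
  "rep Z = (SOME f. f \<in> Z)"

text \<open>The operations act on the representatives chosen by \<open>rep\<close>; the rules
  \<open>quotient_simps\<close> show that the choice does not matter.\<close>

definition quotient_space :: "('l list \<Rightarrow> complex) set nc_space" where
  "quotient_space = \<lparr>carrier = cls ` {f. finite {w. f w \<noteq> 0}},
     mult = (\<lambda>Z Y. cls (convolution (rep Z) (rep Y))), one = cls (unit_word []),
     zero = cls (\<lambda>w. 0), add = (\<lambda>Z Y. cls (\<lambda>w. rep Z w + rep Y w)),
     smult = (\<lambda>c Z. cls (\<lambda>w. c * rep Z w)),
     involution = (\<lambda>Z. cls (star (rep Z))), state = (\<lambda>Z. functional (rep Z) [])\<rparr>"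

section \<open>Well-definedness of the quotient operations\<close>

lemma cls_eq: "functional f = functional g \<Longrightarrow> cls f = cls g"
  by (simp add: cls_def)

lemma rep_cls: "finite {w. f w \<noteq> 0} \<Longrightarrow> finite {w. rep (cls f) w \<noteq> 0} \<and> functional (rep (cls f)) = functional f"
proof -
  assume "finite {w. f w \<noteq> 0}"
  hence "f \<in> cls f" by (simp add: cls_def)
  hence "rep (cls f) \<in> cls f" unfolding rep_def by (rule someI[of "\<lambda>h. h \<in> cls f"])
  thus ?thesis by (simp add: cls_def)
qed

lemma functional_add:
  "finite {w. f w \<noteq> 0} \<Longrightarrow> finite {w. g w \<noteq> 0} \<Longrightarrow>
    functional (\<lambda>w. f w + g w) = (\<lambda>u. functional f u + functional g u)"
  by (simp add: functional_def pairing_add_left)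

lemma functional_scale: "functional (\<lambda>w. c * f w) = (\<lambda>u. c * functional f u)"
  by (simp add: functional_def pairing_scale_left)

lemma functional_zero: "functional (\<lambda>w. 0) = (\<lambda>u. 0)"
  by (simp add: functional_def pairing_zero_left)

lemma functional_unit_word: "functional (unit_word v) = (\<lambda>u. \<nu> (u @ v))"
  by (simp add: functional_def)

lemma functional_convolution:
  assumes "finite {w. f w \<noteq> 0}" "finite {w. g w \<noteq> 0}"
  shows "functional (convolution f g) = (\<lambda>u. pairing f (\<lambda>a. pairing g (\<lambda>b. \<nu> (u @ a @ b))))"
  by (simp only: functional_def pairing_convolution[OF assms])

lemma functional_convolution_left:
  assumes "finite {w. f w \<noteq> 0}" "finite {w. g w \<noteq> 0}"
  shows "functional (convolution f g) = (\<lambda>u. pairing f (\<lambda>a. functional g (u @ a)))"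
  unfolding functional_convolution[OF assms] by (simp add: functional_def)

text \<open>The trace property rotates the left factor to the end of the word, so it enters only
  through its functional. By \<open>functional_convolution_left\<close> the same is true of the
  right factor; together they make the kernel a two-sided ideal.\<close>

lemma functional_convolution_right:
  assumes "finite {w. f w \<noteq> 0}" "finite {w. g w \<noteq> 0}"
  shows "functional (convolution f g) = (\<lambda>u. pairing g (\<lambda>b. functional f (b @ u)))"
proof -
  have "\<nu> (u @ a @ b) = \<nu> ((b @ u) @ a)" for u a b
    using \<nu>_tracial[of "u @ a" b] by simp
  thus ?thesis
    unfolding functional_convolution[OF assms] pairing_swap[of f] by (simp only: functional_def)
qed

lemma functional_star: "functional (star f) = (\<lambda>u. cnj (functional f (rev u)))"
proof -
  have "cnj (\<nu> (u @ rev w)) = \<nu> (rev u @ w)" for u w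
    using \<nu>_rev[of "u @ rev w"] \<nu>_tracial[of w "rev u"] by simp
  thus ?thesis by (simp add: functional_def pairing_star)
qed

lemma quotient_simps_unary:
  assumes f: "finite {w. f w \<noteq> 0}"
  shows "c \<odot>\<^bsub>quotient_space\<^esub> cls f = cls (\<lambda>w. c * f w)"
    and "involution quotient_space (cls f) = cls (star f)"
    and "state quotient_space (cls f) = functional f []"
  using rep_cls[OF f] by (auto simp: quotient_space_def functional_scale functional_star intro!: cls_eq)

lemma quotient_simps_binary:
  assumes f: "finite {w. f w \<noteq> 0}" and g: "finite {w. g w \<noteq> 0}"
  shows "cls f \<otimes>\<^bsub>quotient_space\<^esub> cls g = cls (convolution f g)"
    and "cls f \<oplus>\<^bsub>quotient_space\<^esub> cls g = cls (\<lambda>w. f w + g w)"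
proof -
  note r = rep_cls[OF f] rep_cls[OF g]
  \<comment> \<open>The factors are replaced one at a time, first the right one and then the left
    one.\<close>
  have "functional (convolution (rep (cls f)) (rep (cls g))) = functional (convolution (rep (cls f)) g)"
    using r g by (simp add: functional_convolution_left)
  also have "\<dots> = functional (convolution f g)"
    using r f g by (simp add: functional_convolution_right)
  finally show "cls f \<otimes>\<^bsub>quotient_space\<^esub> cls g = cls (convolution f g)"
    by (auto simp: quotient_space_def intro!: cls_eq)
  show "cls f \<oplus>\<^bsub>quotient_space\<^esub> cls g = cls (\<lambda>w. f w + g w)"
    using r f g by (auto simp: quotient_space_def functional_add intro!: cls_eq)
qed

lemmas quotient_simps = quotient_simps_unary quotient_simps_binary

lemma quotient_consts:
  "\<one>\<^bsub>quotient_space\<^esub> = cls (unit_word [])" "\<zero>\<^bsub>quotient_space\<^esub> = cls (\<lambda>w. 0)"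
  by (simp_all add: quotient_space_def)

lemma quotient_carrierI [simp]: "finite {w. f w \<noteq> 0} \<Longrightarrow> cls f \<in> carrier quotient_space"
  by (auto simp: quotient_space_def)

lemma quotient_carrierE:
  assumes "Z \<in> carrier quotient_space"
  obtains f where "finite {w. f w \<noteq> 0}" "Z = cls f"
  using assms by (auto simp: quotient_space_def)

lemma finite_support_ops [simp]:
  fixes f g :: "'w \<Rightarrow> complex"
  shows "finite {w. f w \<noteq> 0} \<Longrightarrow> finite {w. g w \<noteq> 0} \<Longrightarrow> finite {w. f w + g w \<noteq> 0}"
    and "finite {w. f w \<noteq> 0} \<Longrightarrow> finite {w. c * f w \<noteq> 0}"
    and "finite {w :: 'w. (0 :: complex) \<noteq> 0}"
proof -
  show "finite {w. f w + g w \<noteq> 0}" if "finite {w. f w \<noteq> 0}" "finite {w. g w \<noteq> 0}"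
    by (rule finite_subset[OF _ finite_UnI[OF that]]) auto
qed auto

text \<open>The Gelfand-Naimark-Segal form \<nu>(f^* g), conjugate-linear in f.\<close>

definition form :: "('l list \<Rightarrow> complex) \<Rightarrow> ('l list \<Rightarrow> complex) \<Rightarrow> complex" where
  "form f g = functional (convolution (star f) g) []"

lemma form_eq:
  assumes "finite {w. f w \<noteq> 0}" "finite {w. g w \<noteq> 0}"
  shows "form f g = cnj (pairing f (\<lambda>a. cnj (functional g (rev a))))"
  using assms by (simp add: form_def functional_convolution_left pairing_star)

lemma form_nonneg: "finite {w. f w \<noteq> 0} \<Longrightarrow> form f f \<in> \<real>\<^sub>\<ge>\<^sub>0"
  using \<nu>_pos[of f] by (simp add: form_eq functional_def pairing_def sum_distrib_left mult.assoc)

lemma form_unit_word: "finite {w. f w \<noteq> 0} \<Longrightarrow> form (unit_word u) f = functional f (rev u)"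
  by (simp add: form_eq)

lemma form_unit_word_right: "finite {w. f w \<noteq> 0} \<Longrightarrow> form f (unit_word u) = cnj (functional f (rev u))"
proof -
  assume "finite {w. f w \<noteq> 0}"
  moreover have "cnj (\<nu> (rev a @ u)) = \<nu> (rev u @ a)" for a
    using \<nu>_rev[of "rev a @ u"] by simp
  ultimately show ?thesis by (simp add: form_eq functional_unit_word) (simp add: functional_def)
qed

text \<open>Cauchy--Schwarz: \<open>form (c f + e) (c f + e) \<ge> 0\<close> is affine in \<open>c\<close> once \<open>form f f = 0\<close>.\<close>

lemma form_eq_0:
  assumes f: "finite {w. f w \<noteq> 0}" and 0: "form f f = 0"
  shows "functional f u = 0"
proof (rule ccontr)
  assume nz: "functional f u \<noteq> 0"
  define z where "z = functional f u"
  \<comment> \<open>The reversal makes \<open>form e f\<close> equal to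
    \<open>functional f u\<close>.\<close>
  define e :: "'l list \<Rightarrow> complex" where "e = unit_word (rev u)"
  have e: "finite {w. e w \<noteq> 0}" by (simp add: e_def)
  have T: "form (\<lambda>w. c * f w + e w) (\<lambda>w. c * f w + e w) = cnj c * cnj z + c * z + form e e" for c
  proof -
    have "form (\<lambda>w. c * f w + e w) (\<lambda>w. c * f w + e w) =
        cnj c * c * form f f + cnj c * form f e + c * form e f + form e e"
      using f e
      by (simp add: form_eq functional_add functional_scale pairing_add_left pairing_scale_left
          pairing_add_right pairing_scale_right algebra_simps)
    thus ?thesis using 0 f by (simp add: e_def z_def form_unit_word form_unit_word_right)
  qed
  have "form e e \<in> \<real>\<^sub>\<ge>\<^sub>0" using form_nonneg[OF e] .
  define t where "t = (Re (form e e) + 1) / (2 * (norm z)\<^sup>2)"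
  have "cnj (- of_real t * cnj z) * cnj z + (- of_real t * cnj z) * z = - (2 * of_real t * (z * cnj z))"
    by (simp add: algebra_simps)
  also have "\<dots> = of_real (- (2 * t * (norm z)\<^sup>2))"
    by (simp add: complex_norm_square[symmetric])
  also have "- (2 * t * (norm z)\<^sup>2) = - (Re (form e e) + 1)"
    using nz by (simp add: t_def z_def)
  finally have "Re (form (\<lambda>w. (- of_real t * cnj z) * f w + e w) (\<lambda>w. (- of_real t * cnj z) * f w + e w)) = - 1"
    unfolding T by simp
  moreover have "form (\<lambda>w. (- of_real t * cnj z) * f w + e w) (\<lambda>w. (- of_real t * cnj z) * f w + e w) \<in> \<real>\<^sub>\<ge>\<^sub>0"
    using f e by (intro form_nonneg finite_support_ops)
  ultimately show False by (simp add: complex_nonneg_Reals_iff)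
qed

text \<open>Equality in the quotient is equality of functionals, so the algebraic laws reduce to
  linearity of \<open>pairing\<close>, the trace property and \<open>\<nu>_rev\<close>. Positivity
  is \<open>form_nonneg\<close>, and faithfulness is \<open>form_eq_0\<close>: a null vector has
  zero functional and hence lies in the zero class.\<close>

lemma nc_prob_space_quotient: "nc_prob_space quotient_space"
proof -
  let ?B = quotient_space
  note qs = quotient_simps quotient_consts
  note fs = functional_add functional_scale functional_zero functional_unit_word
    functional_convolution functional_star pairing_add_left pairing_scale_left pairing_zero_left
    pairing_add_right pairing_scale_right pairing_convolution
  have ag: "abelian_group ?B"
  proof (rule abelian_groupI)
    fix Z assume "Z \<in> carrier ?B"
    then obtain f where f: "finite {w. f w \<noteq> 0}" "Z = cls f" by (rule quotient_carrierE)
    have "cls (\<lambda>w. (- 1) * f w) \<oplus>\<^bsub>?B\<^esub> Z = \<zero>\<^bsub>?B\<^esub>"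
      using f by (simp add: qs)
    thus "\<exists>Y\<in>carrier ?B. Y \<oplus>\<^bsub>?B\<^esub> Z = \<zero>\<^bsub>?B\<^esub>"
      by (rule bexI) (rule quotient_carrierI, rule finite_support_ops(2)[OF f(1)])
  qed (((elim quotient_carrierE)?, simp add: qs add_ac)+)
  have mon: "monoid ?B"
    by (rule monoidI; (elim quotient_carrierE)?; simp add: qs; (rule cls_eq)?;
        simp add: fs functional_def)
  have ring: "ring ?B"
    by (rule ringI[OF ag mon]; elim quotient_carrierE; simp add: qs; rule cls_eq; simp add: fs)
  have mod: "module complex_ring ?B"
    by (rule moduleI[OF cring_from_type_algebra ag]; elim quotient_carrierE; simp add: qs algebra_simps)
  have "nc_prob_space_axioms ?B"
  proof
    fix Z Y c assume "Z \<in> carrier ?B" "Y \<in> carrier ?B"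
    then obtain f g where f: "finite {w. f w \<noteq> 0}" "Z = cls f" and g: "finite {w. g w \<noteq> 0}" "Y = cls g"
      by (metis quotient_carrierE)
    show "involution ?B (Z \<otimes>\<^bsub>?B\<^esub> Y) = involution ?B Y \<otimes>\<^bsub>?B\<^esub> involution ?B Z"
    proof -
      have "cnj (\<nu> (u @ rev a @ rev b)) = \<nu> (rev u @ b @ a)" for u a b
        using \<nu>_rev[of "u @ rev a @ rev b"] \<nu>_tracial[of "b @ a" "rev u"] by simp
      hence "functional (star (convolution f g)) = functional (convolution (star g) (star f))"
        using f g by (simp add: fs pairing_star pairing_swap[of f])
      thus ?thesis using f g by (auto simp: qs intro!: cls_eq)
    qed
    show "state ?B (Z \<otimes>\<^bsub>?B\<^esub> Y) = state ?B (Y \<otimes>\<^bsub>?B\<^esub> Z)"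
      using f g \<nu>_tracial by (simp add: qs functional_convolution pairing_swap[of f])
    show "(c \<odot>\<^bsub>?B\<^esub> Z) \<otimes>\<^bsub>?B\<^esub> Y = c \<odot>\<^bsub>?B\<^esub> (Z \<otimes>\<^bsub>?B\<^esub> Y)"
      "Z \<otimes>\<^bsub>?B\<^esub> (c \<odot>\<^bsub>?B\<^esub> Y) = c \<odot>\<^bsub>?B\<^esub> (Z \<otimes>\<^bsub>?B\<^esub> Y)"
      "involution ?B (Z \<oplus>\<^bsub>?B\<^esub> Y) = involution ?B Z \<oplus>\<^bsub>?B\<^esub> involution ?B Y"
      using f g by (auto simp: qs fs intro!: cls_eq)
    show "state ?B (Z \<oplus>\<^bsub>?B\<^esub> Y) = state ?B Z + state ?B Y"
      using f g by (simp add: qs fs)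
  next
    fix Z c assume "Z \<in> carrier ?B"
    then obtain f where f: "finite {w. f w \<noteq> 0}" "Z = cls f" by (rule quotient_carrierE)
    have eq: "state ?B (involution ?B Z \<otimes>\<^bsub>?B\<^esub> Z) = form f f"
      using f by (simp add: qs form_def)
    show "involution ?B Z \<in> carrier ?B" using f by (simp add: qs)
    show "involution ?B (involution ?B Z) = Z"
      using f by (simp add: qs) (rule cls_eq, simp add: fs)
    show "involution ?B (c \<odot>\<^bsub>?B\<^esub> Z) = cnj c \<odot>\<^bsub>?B\<^esub> involution ?B Z"
      using f by (simp add: qs) (rule cls_eq, simp add: fs)
    show "state ?B (c \<odot>\<^bsub>?B\<^esub> Z) = c * state ?B Z" using f by (simp add: qs fs)
    show "state ?B (involution ?B Z \<otimes>\<^bsub>?B\<^esub> Z) \<in> \<real>\<^sub>\<ge>\<^sub>0"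
      unfolding eq using form_nonneg[OF f(1)] .
    show "Z = \<zero>\<^bsub>?B\<^esub>" if "state ?B (involution ?B Z \<otimes>\<^bsub>?B\<^esub> Z) = 0"
    proof -
      have "functional f = (\<lambda>u. 0)" using form_eq_0[OF f(1)] that unfolding eq by blast
      thus ?thesis unfolding f(2) quotient_consts by (intro cls_eq) (simp add: fs)
    qed
  next
    show "state ?B \<one>\<^bsub>?B\<^esub> = 1" by (simp add: qs fs \<nu>_Nil)
  qed
  with ring mod show ?thesis by (simp add: nc_prob_space_def)
qed

lemma state_quotient_word:
  "list_prod quotient_space (map (\<lambda>r. cls (unit_word [r])) ws) = cls (unit_word ws)"
proof (induction ws)
  case Nil
  thus ?case by (simp add: list_prod_def quotient_consts)
next
  case (Cons r ws)
  have "list_prod quotient_space (map (\<lambda>r. cls (unit_word [r])) (r # ws)) =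
      cls (convolution (unit_word [r]) (unit_word ws))"
    using Cons by (simp add: list_prod_def quotient_simps)
  also have "\<dots> = cls (unit_word (r # ws))"
    by (rule cls_eq) (simp add: functional_convolution functional_unit_word)
  finally show ?case .
qed

theorem word_state_realization:
  obtains B :: "('l list \<Rightarrow> complex) set nc_space" and s where
    "nc_prob_space B" "\<And>r. self_adjoint B (s r)"
    "\<And>ws. state B (list_prod B (map s ws)) = \<nu> ws"
proof
  show "nc_prob_space quotient_space" by (rule nc_prob_space_quotient)
  show "self_adjoint quotient_space (cls (unit_word [r]))" for r
  proof -
    have "functional (star (unit_word [r])) = functional (unit_word [r])"
      using \<nu>_rev[of "rev u @ [r]" for u] \<nu>_tracial[of "[r]"]
      by (simp add: functional_star functional_unit_word)
    thus ?thesis by (auto simp: self_adjoint_def quotient_simps intro!: cls_eq)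
  qed
  show "state quotient_space (list_prod quotient_space (map (\<lambda>r. cls (unit_word [r])) ws)) = \<nu> ws" for ws
    by (simp add: state_quotient_word quotient_simps functional_unit_word)
qed

end

section \<open>The limit distribution\<close>

context nc_prob_space
begin

lemma involution_one: "involution A \<one> = \<one>"
proof -
  have c: "involution A \<one> \<in> carrier A" by (simp add: involution_closed)
  have "involution A (involution A \<one> \<otimes> \<one>) = involution A \<one> \<otimes> \<one>"
    using c involution_mult[of "involution A \<one>" \<one>] by (simp add: involution_involution)
  thus ?thesis using c by (simp add: involution_involution)
qed

lemma involution_zero: "involution A \<zero> = \<zero>"
  using involution_smult[of \<one> 0] smult_l_null[of \<one>] smult_l_null[of "involution A \<one>"]
  by (simp add: involution_closed)

lemma involution_finsum:
  assumes "finite I" "\<And>i. i \<in> I \<Longrightarrow> f i \<in> carrier A"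
  shows "involution A (finsum A f I) = finsum A (\<lambda>i. involution A (f i)) I"
  using assms
proof (induction I)
  case empty
  thus ?case by (simp add: involution_zero)
next
  case (insert i I)
  have "f \<in> I \<rightarrow> carrier A" "(\<lambda>i. involution A (f i)) \<in> I \<rightarrow> carrier A"
    using insert.prems by (auto simp: involution_closed)
  thus ?case using insert by (simp add: finsum_insert finsum_closed involution_add involution_closed)
qed

lemma self_adjoint_normalized_sum:
  assumes "\<And>k. k \<in> {1..n} \<Longrightarrow> self_adjoint A (y k)"
  shows "self_adjoint A (normalized_sum A n y)"
proof -
  have y: "y k \<in> carrier A" "involution A (y k) = y k" if "k \<in> {1..n}" for k
    using assms[OF that] by (auto simp: self_adjoint_def)
  have "finsum A (\<lambda>k. involution A (y k)) {1..n} = finsum A y {1..n}"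
    using y by (intro finsum_cong') auto
  moreover have "finsum A y {1..n} \<in> carrier A" using y by (intro finsum_closed) auto
  ultimately show ?thesis
    using involution_finsum[of "{1..n}" y] y
    by (simp add: self_adjoint_def normalized_sum_def involution_smult)
qed

lemma involution_list_prod:
  "\<forall>x\<in>set xs. self_adjoint A x \<Longrightarrow> involution A (list_prod A xs) = list_prod A (rev xs)"
proof (induction xs)
  case Nil
  thus ?case by (simp add: involution_one)
next
  case (Cons x xs)
  hence "set xs \<subseteq> carrier A" "x \<in> carrier A" by (auto simp: self_adjoint_def)
  thus ?case using Cons by (simp add: involution_mult list_prod_append self_adjoint_def)
qed

text \<open>Use that \<open>state A (x\<^sup>* x)\<close> is real for \<open>x = 1 + y\<close> and for \<open>x = 1 + \<i> y\<close>.\<close>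

lemma state_involution:
  assumes y: "y \<in> carrier A"
  shows "state A (involution A y) = cnj (state A y)"
proof -
  let ?y' = "involution A y"
  have y': "?y' \<in> carrier A" using y by (rule involution_closed)
  have real: "Im (state A (involution A z \<otimes> z)) = 0" if "z \<in> carrier A" for z
    using state_pos[OF that] by (simp add: complex_nonneg_Reals_iff)
  have "Im (1 + c * state A y + cnj c * (state A ?y' + c * state A (?y' \<otimes> y))) = 0" for c
  proof -
    have "state A (involution A (\<one> \<oplus> c \<odot> y) \<otimes> (\<one> \<oplus> c \<odot> y)) =
        1 + c * state A y + cnj c * (state A ?y' + c * state A (?y' \<otimes> y))"
      using y y' by (simp add: involution_add involution_smult involution_one l_distr r_distr
          smult_mult_left smult_mult_right state_add state_smult state_one algebra_simps)
    thus ?thesis using real[of "\<one> \<oplus> c \<odot> y"] y by simp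
  qed
  from this[of 1] this[of \<i>] real[OF y] show ?thesis
    by (simp add: complex_eq_iff)
qed

lemma word_state_moments:
  assumes S: "\<And>r. self_adjoint A (S r)"
  shows "word_state (\<lambda>ws. state A (list_prod A (map S ws)))"
proof
  have c: "S r \<in> carrier A" for r using S by (simp add: self_adjoint_def)
  hence cl: "set (map S ws) \<subseteq> carrier A" for ws by auto
  show "state A (list_prod A (map S [])) = 1" by (simp add: state_one)
  show "state A (list_prod A (map S (u @ v))) = state A (list_prod A (map S (v @ u)))" for u v
    using cl[of u] cl[of v] by (simp only: map_append list_prod_append state_tracial[OF list_prod_closed list_prod_closed])
  have inv: "involution A (list_prod A (map S ws)) = list_prod A (map S (rev ws))" for ws
    using S by (simp add: involution_list_prod rev_map)
  show "state A (list_prod A (map S (rev ws))) = cnj (state A (list_prod A (map S ws)))" for ws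
    unfolding inv[symmetric] using cl[of ws] by (intro state_involution list_prod_closed)
  show "(\<Sum>u | f u \<noteq> 0. \<Sum>v | f v \<noteq> 0. cnj (f u) * f v * state A (list_prod A (map S (rev u @ v)))) \<in> \<real>\<^sub>\<ge>\<^sub>0"
    if fin: "finite {w. f w \<noteq> 0}" for f
  proof -
    let ?W = "{w. f w \<noteq> 0}" and ?P = "\<lambda>w. list_prod A (map S w)"
    \<comment> \<open>The double sum of the positivity axiom is the state of e^* e for this
      combination e of words.\<close>
    let ?e = "finsum A (\<lambda>w. f w \<odot> ?P w) ?W"
    have P: "?P w \<in> carrier A" for w using cl[of w] by (rule list_prod_closed)
    have e: "?e \<in> carrier A" using P by (intro finsum_closed) auto
    have ie: "involution A ?e \<in> carrier A" using e by (rule involution_closed)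
    have eq: "involution A ?e = finsum A (\<lambda>w. cnj (f w) \<odot> ?P (rev w)) ?W"
      using P fin by (simp add: involution_finsum involution_smult inv)
    have "state A (involution A ?e \<otimes> ?e) = state A (\<one> \<otimes> (finsum A (\<lambda>w. cnj (f w) \<odot> ?P (rev w)) ?W \<otimes> ?e))"
      unfolding eq[symmetric] using e ie by simp
    also have "\<dots> = (\<Sum>u\<in>?W. state A (\<one> \<otimes> ((cnj (f u) \<odot> ?P (rev u)) \<otimes> ?e)))"
      using fin e P by (intro state_mult_finsum) auto
    also have "\<dots> = (\<Sum>u\<in>?W. cnj (f u) * state A (?P (rev u) \<otimes> (?e \<otimes> \<one>)))"
    proof (rule sum.cong[OF refl])
      fix u
      show "state A (\<one> \<otimes> ((cnj (f u) \<odot> ?P (rev u)) \<otimes> ?e)) =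
          cnj (f u) * state A (?P (rev u) \<otimes> (?e \<otimes> \<one>))"
        unfolding state_mult_smult[OF one_closed e P] r_one[OF e]
        by (simp only: l_one[OF m_closed[OF P e]])
    qed
    also have "\<dots> = (\<Sum>u\<in>?W. cnj (f u) * (\<Sum>v\<in>?W. state A (?P (rev u) \<otimes> ((f v \<odot> ?P v) \<otimes> \<one>))))"
      using fin P by (simp only: state_mult_finsum[OF fin P one_closed scale_closed[OF P]])
    also have "\<dots> = (\<Sum>u\<in>?W. \<Sum>v\<in>?W. cnj (f u) * f v * state A (?P (rev u @ v)))"
      using P cl by (simp add: smult_mult_right state_smult sum_distrib_left mult.assoc list_prod_append)
    finally show ?thesis using state_pos[OF e] by simp
  qed
qed

end

text \<open>Each axiom is an equation or a closed condition on finitely many values, so it survives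
  pointwise limits. Faithfulness, which does not survive in general, is for this reason not an axiom
  of \<open>word_state\<close>.\<close>

lemma word_state_limit:
  assumes lim: "\<And>w. (\<lambda>n. \<tau> n w) \<longlonglongrightarrow> \<nu> w" and ws: "\<And>n. n \<ge> 1 \<Longrightarrow> word_state (\<tau> n)"
  shows "word_state \<nu>"
proof
  have ev: "eventually P sequentially" if "\<And>n::nat. n \<ge> 1 \<Longrightarrow> P n" for P
    using that by (rule eventually_sequentiallyI)
  have eq: "a = b" if "f \<longlonglongrightarrow> a" "g \<longlonglongrightarrow> b" "\<And>n. n \<ge> 1 \<Longrightarrow> f n = g n" for f g and a b :: complex
  proof -
    have "g \<longlonglongrightarrow> a" using that(1) by (rule Lim_transform_eventually) (rule ev[OF that(3)])
    thus ?thesis using that(2) by (rule LIMSEQ_unique)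
  qed
  show "\<nu> [] = 1" by (rule eq[OF lim tendsto_const]) (rule word_state.\<nu>_Nil[OF ws])
  show "\<nu> (u @ v) = \<nu> (v @ u)" for u v by (rule eq[OF lim lim]) (rule word_state.\<nu>_tracial[OF ws])
  show "\<nu> (rev w) = cnj (\<nu> w)" for w
    by (rule eq[OF lim tendsto_cnj[OF lim]]) (rule word_state.\<nu>_rev[OF ws])
  show "(\<Sum>u | f u \<noteq> 0. \<Sum>v | f v \<noteq> 0. cnj (f u) * f v * \<nu> (rev u @ v)) \<in> \<real>\<^sub>\<ge>\<^sub>0"
    if fin: "finite {w. f w \<noteq> 0}" for f
  proof (rule Lim_in_closed_set)
    show "closed (\<real>\<^sub>\<ge>\<^sub>0 :: complex set)" by (rule closed_nonneg_Reals_complex)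
    show "(\<lambda>n. \<Sum>u | f u \<noteq> 0. \<Sum>v | f v \<noteq> 0. cnj (f u) * f v * \<tau> n (rev u @ v))
        \<longlonglongrightarrow> (\<Sum>u | f u \<noteq> 0. \<Sum>v | f v \<noteq> 0. cnj (f u) * f v * \<nu> (rev u @ v))"
      by (intro tendsto_sum tendsto_mult tendsto_const lim)
    show "\<forall>\<^sub>F n in sequentially. (\<Sum>u | f u \<noteq> 0. \<Sum>v | f v \<noteq> 0. cnj (f u) * f v * \<tau> n (rev u @ v)) \<in> \<real>\<^sub>\<ge>\<^sub>0"
      by (rule ev) (rule word_state.\<nu>_pos[OF ws fin])
  qed simp
qed

text \<open>Distinct blocks are disjoint, so their minima differ, and each edge can be directed from
  the smaller minimum to the larger one.\<close>

lemma ex_orientation_intersection_graph: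
  assumes \<pi>: "\<pi> \<in> pair_partitions p"
  shows "\<exists>D. orientation (intersection_graph \<pi>) D"
proof
  let ?G = "intersection_graph \<pi>"
  let ?D = "{(U, V). (U, V) \<in> parcs ?G \<and> Min U < Min V}"
  have sym: "(V, U) \<in> parcs ?G" if "(U, V) \<in> parcs ?G" for U V
    using that by (auto simp: intersection_graph_def crossing_def)
  have "Min U \<noteq> Min V" if "(U, V) \<in> parcs ?G" for U V
  proof
    assume eq: "Min U = Min V"
    have UV: "U \<in> \<pi>" "V \<in> \<pi>" "U \<noteq> V" using that by (auto simp: intersection_graph_def)
    have "Min W \<in> W" if "W \<in> \<pi>" for W
      using pair_partition_block[OF \<pi> that] by (intro Min_in) (auto intro: finite_subset card_ge_0_finite)
    thus False using block_of_eq[OF \<pi>] UV eq by metis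
  qed
  thus "orientation ?G ?D"
    unfolding orientation_def using sym by (auto simp: neq_iff)
qed

theorem theorem5p1:
  fixes A :: "'a nc_space"
    and g :: "nat \<Rightarrow> (nat \<times> 'l::finite) pair_pre_digraph"
    and w :: "real \<Rightarrow> real \<Rightarrow> real^'l^'l"
    and a :: 'a
    and x :: "nat \<Rightarrow> nat \<Rightarrow> 'l \<Rightarrow> 'a"
  assumes "nc_prob_space A"
    and "\<And>n. n \<ge> 1 \<Longrightarrow> pair_graph (g n) \<and> pverts (g n) = {1..n} \<times> UNIV"
    and "decorated_graphon w"
    and "graphon_converges (\<lambda>n. block_graphon n (g n)) w"
    and "self_adjoint A a" and "state A a = 0" and "state A (a [^]\<^bsub>A\<^esub> (2::nat)) = 1"
    and "\<And>n k r. n \<ge> 1 \<Longrightarrow> k \<in> {1..n} \<Longrightarrow> self_adjoint A (x n k r) \<and> same_law A (x n k r) a"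
    and "\<And>n. n \<ge> 1 \<Longrightarrow> g_independent A (g n) (\<lambda>(k, r). x n k r)"
  shows "\<exists>(B :: ('l list \<Rightarrow> complex) set nc_space) (s :: 'l \<Rightarrow> ('l list \<Rightarrow> complex) set).
    nc_prob_space B \<and> (\<forall>r. self_adjoint B (s r)) \<and>
    converges_in_distribution A (\<lambda>n r. normalized_sum A n (\<lambda>k. x n k r)) B s \<and>
    (\<forall>D. (\<forall>p. \<forall>\<pi>\<in>pair_partitions p. orientation (intersection_graph \<pi>) (D \<pi>)) \<longrightarrow>
      (\<forall>p\<ge>1. \<forall>l :: nat \<Rightarrow> 'l.
        state B (ordered_prod B p (\<lambda>u. s (l u))) = complex_of_real (limit_moment D w p l)))"
proof -
  interpret A: nc_prob_space A by fact
  let ?S = "\<lambda>n r. normalized_sum A n (\<lambda>k. x n k r)"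
  let ?\<tau> = "\<lambda>n ws. state A (list_prod A (map (?S n) ws))"
  have mom: "(\<lambda>n. state A (ordered_prod A p (\<lambda>u. ?S n (l u)))) \<longlonglongrightarrow> complex_of_real (limit_moment D w p l)"
    if "p \<ge> 1" "\<forall>\<pi>\<in>pair_partitions p. orientation (intersection_graph \<pi>) (D \<pi>)" for p D l
    using assms that by (intro moments_tendsto[of A g w a x p D l]) (auto simp: self_adjoint_def)
  \<comment> \<open>Some orientation is needed to write the limit down before the space
    exists.\<close>
  obtain D0 where D0: "\<forall>p. \<forall>\<pi>\<in>pair_partitions p. orientation (intersection_graph \<pi>) (D0 \<pi>)"
  proof
    show "\<forall>p. \<forall>\<pi>\<in>pair_partitions p. orientation (intersection_graph \<pi>) (SOME D. orientation (intersection_graph \<pi>) D)"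
      using ex_orientation_intersection_graph by (metis someI)
  qed
  \<comment> \<open>Convergence is known for p at least 1 only, so the empty word receives the state
    of the unit, 1, separately. The shift u - 1 turns a list, indexed from 0, into a word indexed
    from 1.\<close>
  define \<nu> where "\<nu> = (\<lambda>ws :: 'l list. if ws = [] then 1 else
    complex_of_real (limit_moment D0 w (length ws) (\<lambda>u. ws ! (u - 1))))"
  have \<tau>: "(\<lambda>n. ?\<tau> n ws) \<longlonglongrightarrow> \<nu> ws" for ws
  proof (cases "ws = []")
    case True
    thus ?thesis by (simp add: \<nu>_def A.state_one)
  next
    case False
    hence "length ws \<ge> 1" by (simp add: Suc_le_eq)
    from mom[OF this, of D0 "\<lambda>u. ws ! (u - 1)"] D0 show ?thesis
      unfolding ordered_prod_nth[of A ws "?S _"] using False by (simp add: \<nu>_def)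
  qed
  have "word_state \<nu>"
  proof (rule word_state_limit[OF \<tau>])
    fix n :: nat assume "n \<ge> 1"
    thus "word_state (?\<tau> n)"
      using assms by (intro A.word_state_moments A.self_adjoint_normalized_sum) auto
  qed
  then obtain B :: "('l list \<Rightarrow> complex) set nc_space" and s where B: "nc_prob_space B"
    and s: "\<And>r. self_adjoint B (s r)" and sB: "\<And>ws. state B (list_prod B (map s ws)) = \<nu> ws"
    by (rule word_state.word_state_realization) blast
  interpret B: nc_prob_space B by fact
  have conv: "(\<lambda>n. state A (ordered_prod A p (\<lambda>u. ?S n (l u)))) \<longlonglongrightarrow> state B (ordered_prod B p (\<lambda>u. s (l u)))" for p l
    using \<tau>[of "map l [1..<p + 1]"]
    unfolding sB[symmetric] A.ordered_prod_eq_list_prod B.ordered_prod_eq_list_prod by (simp add: comp_def)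
  \<comment> \<open>The space was built with \<open>D0\<close>, but for any other orientation D the
    moments of the sums converge to the formula for D as well, and limits are unique.\<close>
  have "state B (ordered_prod B p (\<lambda>u. s (l u))) = complex_of_real (limit_moment D w p l)"
    if "\<forall>p. \<forall>\<pi>\<in>pair_partitions p. orientation (intersection_graph \<pi>) (D \<pi>)" "p \<ge> 1" for D p l
    using conv mom[OF that(2), of D l] that(1) by (intro LIMSEQ_unique) auto
  with B s conv show ?thesis unfolding converges_in_distribution_def by blast
qed

end
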